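(* Let $n\ge 1$ be an integer, $0<p\le 1$, $0\le\rho\le 1$, $\lambda_s,\lambda_f\ge 0$, and let $f_0\neq f_1$ be probability density functions on $\mathbb{R}$. Consider the quickest detection problem with closed-loop control of the probability of a sensor being awake, $$\min_{\tau,\,q_1,\dots,q_\tau}\ \mathsf{E}\Big[\lambda_f(1-\Pi_\tau)+\sum_{k=0}^{\tau-1}\big(\Pi_k+\lambda_s n q_{k+1}\big)\Big],$$ where the minimum is over all admissible policies (stopping decisions and probabilities $q_{k+1}\in[0,1]$ chosen as functions of the information $\mathbf{I}_k$) and $\Pi_k=\mathsf{P}\{T\le k\mid \mathbf{I}_k\}$. Then there is a constant $\Gamma\in[0,1]$, depending on the parameters of the problem (the false alarm cost $\lambda_f$, the distribution of $T$, the densities $f_0,f_1$, and $n,\lambda_s$), such that the optimal stopping rule is the threshold rule $$\tau^*=\inf\{k\ge 0:\ \Pi_k\ge\Gamma\},$$ i.e. there is an optimal policy whose stopping time is $\tau^*$.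
   Context: Model. The change time $T\in\{0,1,2,\dots\}$ has distribution $\mathsf{P}\{T=0\}=\rho$ and $\mathsf{P}\{T=k\}=(1-\rho)(1-p)^{k-1}p$ for $k\ge 1$. There are $n$ sensors. Given $T$, the potential observations $X_k^{(i)}$ ($k\ge1$, $1\le i\le n$) are independent across sensors and time, with density $f_0$ if $k<T$ and density $f_1$ if $k\ge T$. At each slot $k=0,1,2,\dots$ a fusion centre, based on the information $\mathbf{I}_k$ (all observation vectors received in slots $1,\dots,k$, including which sensors were awake, and all actions taken in slots $0,\dots,k-1$; $\mathbf{I}_0$ is trivial), takes an action $A_k$, a measurable function of $\mathbf{I}_k$: either stop and raise an alarm (action $(1,0)$), or continue with awake probability $q\in[0,1]$ (action $(0,q)$). If it continues with $q=q_{k+1}$, then in slot $k+1$ each sensor is, independently of the others and of everything else given $\mathbf{I}_k$, awake with probability $q_{k+1}$, so that the number $M_{k+1}$ of awake sensors equals $m$ with probability $\gamma_m(q_{k+1})=\binom{n}{m}q_{k+1}^m(1-q_{k+1})^{n-m}$; the fusion centre receives $X_{k+1}^{(i)}$ for exactly the awake sensors $i$. The stopping time $\tau$ is the first $k$ at which the stop action is taken. An admissible policy is any such sequence of measurable decision functions. If $\tau=\infty$, the cost is $\sum_{k=0}^\infty(\Pi_k+\lambda_s nq_{k+1})$. The a posteriori probability $\Pi_k=\mathsf{P}\{T\le k\mid\mathbf{I}_k\}$ satisfies $\Pi_0=\rho$ and, while continuing, $$\Pi_{k}=\frac{\widetilde\Pi_{k-1}\phi_1(\mathbf{Y}_{k})}{\widetilde\Pi_{k-1}\phi_1(\mathbf{Y}_{k})+(1-\widetilde\Pi_{k-1})\phi_0(\mathbf{Y}_{k})},\qquad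 \widetilde\Pi_{k-1}=\Pi_{k-1}+(1-\Pi_{k-1})p,$$ where $\mathbf{Y}_k$ is the vector of observations received in slot $k$ and $\phi_j(\mathbf{y})=\prod_i f_j(y_i)$ (empty product equal to $1$). The number $\lambda_f$ is the cost of false alarm; in the constrained version of the problem with constraint $\mathsf{P}\{\tau<T\}\le\alpha$, it plays the role of a Lagrange multiplier chosen so that the constraint holds with equality, and the constraint level $\alpha$ enters only through $\lambda_f$. *)

theory Defs
  imports "HOL-Probability.Probability"
begin

definition prob_density :: "(real \<Rightarrow> real) \<Rightarrow> bool" where
  "prob_density f \<longleftrightarrow>
     f \<in> borel_measurable borel \<and> (\<forall>x. 0 \<le> f x) \<and> (\<integral>\<^sup>+ x. ennreal (f x) \<partial>lborel) = 1"


subsection \<open>Exogenous randomness\<close>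

definition change_time_pmf :: "real \<Rightarrow> real \<Rightarrow> nat pmf" where
  "change_time_pmf \<rho> p =
     bind_pmf (bernoulli_pmf \<rho>) (\<lambda>b. if b then return_pmf 0 else map_pmf Suc (geometric_pmf p))"

lemma pmf_change_time_0:
  assumes "0 \<le> \<rho>" "\<rho> \<le> 1"
  shows "pmf (change_time_pmf \<rho> p) 0 = \<rho>"
  using assms by (simp add: change_time_pmf_def pmf_bind pmf_map_outside)

lemma pmf_change_time_Suc:
  assumes "0 \<le> \<rho>" "\<rho> \<le> 1" "0 < p" "p \<le> 1" "k \<ge> 1"
  shows "pmf (change_time_pmf \<rho> p) k = (1 - \<rho>) * (1 - p) ^ (k - 1) * p"
proof -
  obtain j where k: "k = Suc j" using assms(5) by (cases k) auto
  show ?thesis using assms by (simp add: k change_time_pmf_def pmf_bind pmf_map_inj')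
qed

text \<open>
  A sample point is a triple of the change time, the potential observations and auxiliary
  variables uniform on the unit interval, the latter two indexed by slot \<open>k \<ge> 1\<close> and
  sensor \<open>1 \<le> i \<le> n\<close>. The uniform variables are independent of each other and of the other
  components and are never seen by the fusion centre. Sensor \<open>i\<close> is awake in slot \<open>k\<close> iff its
  uniform variable lies below the awake probability chosen for that slot; hence, given the
  information at the time of the choice, the sensors are awake independently of each other and
  of everything else, each with the chosen probability.
\<close>

type_synonym sample = "nat \<times> (nat \<times> nat \<Rightarrow> real) \<times> (nat \<times> nat \<Rightarrow> real)"

definition observations_given ::
  "nat \<Rightarrow> (real \<Rightarrow> real) \<Rightarrow> (real \<Rightarrow> real) \<Rightarrow> nat \<Rightarrow> (nat \<times> nat \<Rightarrow> real) measure" where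
  "observations_given n f0 f1 t =
     (\<Pi>\<^sub>M (k, i) \<in> {1..} \<times> {1..n}. density lborel (\<lambda>x. ennreal (if k < t then f0 x else f1 x)))"

definition awake_noise :: "nat \<Rightarrow> (nat \<times> nat \<Rightarrow> real) measure" where
  "awake_noise n = (\<Pi>\<^sub>M _ \<in> {1..} \<times> {1..n}. uniform_measure lborel {0..1})"

definition sensor_measure ::
  "nat \<Rightarrow> real \<Rightarrow> real \<Rightarrow> (real \<Rightarrow> real) \<Rightarrow> (real \<Rightarrow> real) \<Rightarrow> sample measure" where
  "sensor_measure n \<rho> p f0 f1 =
     measure_pmf (change_time_pmf \<rho> p) \<bind>
       (\<lambda>t. return (count_space UNIV) t \<Otimes>\<^sub>M (observations_given n f0 f1 t \<Otimes>\<^sub>M awake_noise n))"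


subsection \<open>Policies and closed-loop dynamics\<close>

text \<open>
  The action \<open>(True, 0)\<close> stops and raises an alarm; \<open>(False, q)\<close> continues with awake
  probability \<open>q\<close>.
\<close>

type_synonym action = "bool \<times> real"

definition action_space :: "action measure" where
  "action_space =
     restrict_space (count_space UNIV \<Otimes>\<^sub>M borel) ({(True, 0)} \<union> {False} \<times> {0..1})"

text \<open>
  What is received from one sensor in one slot is \<open>(True, x)\<close> if it is awake and observes
  \<open>x\<close>, and the dummy value \<open>(False, 0)\<close> if it is asleep. The information at time \<open>k\<close> consists
  of the receptions in slots \<open>1, \<dots>, k\<close> and the actions of slots \<open>0, \<dots>, k - 1\<close>.
\<close>

type_synonym reception = "nat \<Rightarrow> bool \<times> real"

type_synonym info = "(nat \<Rightarrow> reception) \<times> (nat \<Rightarrow> action)"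

definition reception_space :: "nat \<Rightarrow> reception measure" where
  "reception_space n = (\<Pi>\<^sub>M _ \<in> {1..n}. count_space UNIV \<Otimes>\<^sub>M borel)"

definition info_space :: "nat \<Rightarrow> nat \<Rightarrow> info measure" where
  "info_space n k = (\<Pi>\<^sub>M _ \<in> {1..k}. reception_space n) \<Otimes>\<^sub>M (\<Pi>\<^sub>M _ \<in> {..<k}. action_space)"

type_synonym policy = "nat \<Rightarrow> info \<Rightarrow> action"

definition admissible :: "nat \<Rightarrow> policy \<Rightarrow> bool" where
  "admissible n A \<longleftrightarrow> (\<forall>k. A k \<in> measurable (info_space n k) action_space)"

fun reception :: "nat \<Rightarrow> real \<Rightarrow> nat \<Rightarrow> sample \<Rightarrow> reception" where
  "reception n q k (t, x, u) =
     (\<lambda>i\<in>{1..n}. if u (k, i) < q then (True, x (k, i)) else (False, 0))"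

text \<open>
  The recursion formally runs on after a stop action, with all sensors asleep in the next slot;
  nothing below depends on what happens after the alarm time.
\<close>

primrec info :: "nat \<Rightarrow> policy \<Rightarrow> nat \<Rightarrow> sample \<Rightarrow> info" where
  "info n A 0 \<omega> = (\<lambda>_. undefined, \<lambda>_. undefined)"
| "info n A (Suc k) \<omega> =
     (let I = info n A k \<omega>; a = A k I
      in ((fst I)(Suc k := reception n (snd a) (Suc k) \<omega>), (snd I)(k := a)))"

definition action_taken :: "nat \<Rightarrow> policy \<Rightarrow> nat \<Rightarrow> sample \<Rightarrow> action" where
  "action_taken n A k \<omega> = A k (info n A k \<omega>)"

definition alarm_time :: "nat \<Rightarrow> policy \<Rightarrow> sample \<Rightarrow> enat" where
  "alarm_time n A \<omega> = Inf (enat ` {k. fst (action_taken n A k \<omega>)})"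


subsection \<open>A posteriori probability and cost\<close>

definition posterior ::
  "nat \<Rightarrow> real \<Rightarrow> real \<Rightarrow> (real \<Rightarrow> real) \<Rightarrow> (real \<Rightarrow> real) \<Rightarrow> policy \<Rightarrow> nat \<Rightarrow> sample \<Rightarrow> real" where
  "posterior n \<rho> p f0 f1 A k =
     (let M = sensor_measure n \<rho> p f0 f1
      in real_cond_exp M (vimage_algebra (space M) (info n A k) (info_space n k))
           (indicator {\<omega> \<in> space M. fst \<omega> \<le> k}))"

text \<open>
  The awake probability used in slot \<open>k + 1\<close> is the second component of the action taken in
  slot \<open>k\<close>. The cost is nonnegative and may be infinite, so it is valued in \<open>ennreal\<close>.
\<close>

definition running_cost ::
  "nat \<Rightarrow> real \<Rightarrow> real \<Rightarrow> real \<Rightarrow> (real \<Rightarrow> real) \<Rightarrow> (real \<Rightarrow> real) \<Rightarrow> policy \<Rightarrow> nat \<Rightarrow> sample \<Rightarrow> ennreal"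
where
  "running_cost n \<rho> p lam_s f0 f1 A k \<omega> =
     ennreal (posterior n \<rho> p f0 f1 A k \<omega> + lam_s * real n * snd (action_taken n A k \<omega>))"

definition total_cost ::
  "nat \<Rightarrow> real \<Rightarrow> real \<Rightarrow> real \<Rightarrow> real \<Rightarrow> (real \<Rightarrow> real) \<Rightarrow> (real \<Rightarrow> real) \<Rightarrow> policy \<Rightarrow> sample \<Rightarrow> ennreal"
where
  "total_cost n \<rho> p lam_s lam_f f0 f1 A \<omega> =
     (case alarm_time n A \<omega> of
        enat m \<Rightarrow> ennreal (lam_f * (1 - posterior n \<rho> p f0 f1 A m \<omega>))
                  + (\<Sum>k<m. running_cost n \<rho> p lam_s f0 f1 A k \<omega>)
      | \<infinity> \<Rightarrow> (\<Sum>k. running_cost n \<rho> p lam_s f0 f1 A k \<omega>))"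

definition expected_cost ::
  "nat \<Rightarrow> real \<Rightarrow> real \<Rightarrow> real \<Rightarrow> real \<Rightarrow> (real \<Rightarrow> real) \<Rightarrow> (real \<Rightarrow> real) \<Rightarrow> policy \<Rightarrow> ennreal" where
  "expected_cost n \<rho> p lam_s lam_f f0 f1 A =
     (\<integral>\<^sup>+ \<omega>. total_cost n \<rho> p lam_s lam_f f0 f1 A \<omega> \<partial>sensor_measure n \<rho> p f0 f1)"

definition optimal_policy ::
  "nat \<Rightarrow> real \<Rightarrow> real \<Rightarrow> real \<Rightarrow> real \<Rightarrow> (real \<Rightarrow> real) \<Rightarrow> (real \<Rightarrow> real) \<Rightarrow> policy \<Rightarrow> bool" where
  "optimal_policy n \<rho> p lam_s lam_f f0 f1 A \<longleftrightarrow>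
     admissible n A \<and>
     (\<forall>B. admissible n B \<longrightarrow>
        expected_cost n \<rho> p lam_s lam_f f0 f1 A \<le> expected_cost n \<rho> p lam_s lam_f f0 f1 B)"

text \<open>
  The posterior is a conditional probability, hence determined only up to null sets: statements
  about the threshold time are therefore meaningful only almost surely.
\<close>

definition threshold_time ::
  "nat \<Rightarrow> real \<Rightarrow> real \<Rightarrow> (real \<Rightarrow> real) \<Rightarrow> (real \<Rightarrow> real) \<Rightarrow> real \<Rightarrow> policy \<Rightarrow> sample \<Rightarrow> enat" where
  "threshold_time n \<rho> p f0 f1 \<Gamma> A \<omega> =
     Inf (enat ` {k. \<Gamma> \<le> posterior n \<rho> p f0 f1 A k \<omega>})"

end

theory Submission
  imports Defs
begin

text \<open>
  The posterior probability \<open>\<pi>\<close> is a controlled Markov process, so the optimal cost is the limit \<open>V\<close>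
  of value iteration for the Bellman operator
  \<open>V(\<pi>) \<mapsto> min (\<lambda>\<^sub>f (1 - \<pi>)) (inf\<^sub>q (\<pi> + \<lambda>\<^sub>s n q + E V(\<pi>')))\<close>. Every iterate bounds the cost of every policy
  from below, up to \<open>\<lambda>\<^sub>f\<close> times the probability that the change has not yet happened. The limit \<open>V\<close>
  is a supersolution of the Bellman equation, so stopping where \<open>\<lambda>\<^sub>f (1 - \<pi>)\<close> attains the outer
  minimum, and otherwise using a measurable minimiser \<open>q\<close>, costs at most \<open>V\<close>. The continuation cost is
  concave and the stopping cost is affine, so the stopping set is an interval; it contains \<open>1\<close>, where
  stopping is free.
\<close>

subsection \<open>Resampling part of an infinite product\<close>

text \<open>The awake decisions depend on the policy, so the information has no product structure
  over time. It is recovered by replacing the coordinates of one slot with an independent copy: the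
  past then fixes q, and the next reception has a density against one reference measure that depends
  on neither q nor the change time. The posterior is an abstract conditional expectation, fixed only
  up to null sets. It is identified almost surely, for all times at once, with a recursive filter
  that is a genuine function of the information; all dynamic programming is done with this filter.
  Bayes' rule divides by a predictive density that may vanish. Homogeneous value functions of
  unnormalised masses cancel this divisor. Two points of regularity remain. The infimum over q must
  be attained by a measurable choice, which rests on the continuation cost being polynomial in q.
  And the stopping interval must contain its left end point, although concavity gives no continuity
  at the boundary of [0, 1]; this is where p > 0 enters a second time, besides making the terminal
  penalty vanish in the lower bound.\<close>

lemma prod_indicator_PiE:
  assumes "finite I" "r \<in> extensional I"
  shows "(\<Prod>i\<in>I. indicator (A i) (r i)) = (indicator (Pi\<^sub>E I A) r :: ennreal)"
  using assms by (auto simp: indicator_def PiE_iff prod_zero_iff)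

text \<open>The preimage of a cylinder is a rectangle: the old point controls the coordinates
  outside \<open>C\<close>, the copy those inside. Its measure is therefore the same product of
  factors, merely split over \<open>J - C\<close> and \<open>J \<inter> C\<close>.\<close>

lemma (in product_prob_space) distr_merge_copy:
  "distr (PiM I M \<Otimes>\<^sub>M PiM I M) (PiM I M) (\<lambda>(x, y). \<lambda>i\<in>I. if i \<in> C then y i else x i) = PiM I M"
    (is "distr ?PP ?P ?f = ?P")
proof (rule measure_eqI_PiM_infinite[of _ I M])
  have f[measurable]: "?f \<in> measurable ?PP ?P"
    unfolding case_prod_beta by (rule measurable_restrict) simp
  interpret PP: pair_prob_space "PiM I M" "PiM I M" ..
  show "finite_measure (distr ?PP ?P ?f)"
    using f by (intro finite_measure.finite_measure_distr PP.finite_measure_axioms)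
  fix A J assume J: "finite J" "J \<subseteq> I" and A: "\<And>i. i \<in> J \<Longrightarrow> A i \<in> sets (M i)"
  let ?K = "J - C" and ?L = "J \<inter> C"
  have "?f -` prod_emb I M J (Pi\<^sub>E J A) \<inter> space ?PP =
      prod_emb I M ?K (Pi\<^sub>E ?K A) \<times> prod_emb I M ?L (Pi\<^sub>E ?L A)"
    using J A[THEN sets.sets_into_space]
    by (auto simp: prod_emb_iff space_pair_measure space_PiM PiE_iff extensional_def split: if_splits) blast+
  then have "emeasure (distr ?PP ?P ?f) (prod_emb I M J (Pi\<^sub>E J A)) =
      emeasure ?PP (prod_emb I M ?K (Pi\<^sub>E ?K A) \<times> prod_emb I M ?L (Pi\<^sub>E ?L A))"
    using J A by (subst emeasure_distr) (auto intro!: sets_PiM_I)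
  also have "\<dots> = (\<Prod>i\<in>?K. emeasure (M i) (A i)) * (\<Prod>i\<in>?L. emeasure (M i) (A i))"
    using J A
    by (subst P.emeasure_pair_measure_Times)
      (auto intro!: sets_PiM_I arg_cong2[where f="(*)"] emeasure_PiM_emb)
  also have "\<dots> = (\<Prod>i\<in>J. emeasure (M i) (A i))"
    using J by (subst prod.union_disjoint[symmetric]) (auto intro!: prod.cong)
  also have "\<dots> = emeasure ?P (prod_emb I M J (Pi\<^sub>E J A))"
    using J A by (simp add: emeasure_PiM_emb)
  finally show "emeasure (distr ?PP ?P ?f) (prod_emb I M J (Pi\<^sub>E J A)) =
    emeasure ?P (prod_emb I M J (Pi\<^sub>E J A))" .
qed simp_all

lemma (in product_prob_space) nn_integral_merge_copy:
  assumes [measurable]: "F \<in> borel_measurable (PiM I M)"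
  shows "(\<integral>\<^sup>+x. F x \<partial>PiM I M) =
    (\<integral>\<^sup>+x. \<integral>\<^sup>+y. F (\<lambda>i\<in>I. if i \<in> C then y i else x i) \<partial>PiM I M \<partial>PiM I M)"
proof -
  have [measurable]: "(\<lambda>z. \<lambda>i\<in>I. if i \<in> C then snd z i else fst z i)
      \<in> measurable (PiM I M \<Otimes>\<^sub>M PiM I M) (PiM I M)"
    by (rule measurable_restrict) simp
  have "(\<integral>\<^sup>+x. F x \<partial>PiM I M) =
      (\<integral>\<^sup>+z. F (\<lambda>i\<in>I. if i \<in> C then snd z i else fst z i) \<partial>(PiM I M \<Otimes>\<^sub>M PiM I M))"
    by (subst distr_merge_copy[of C, symmetric])
      (subst nn_integral_distr, auto simp: case_prod_beta)
  also have "\<dots> = (\<integral>\<^sup>+x. \<integral>\<^sup>+y. F (\<lambda>i\<in>I. if i \<in> C then y i else x i) \<partial>PiM I M \<partial>PiM I M)"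
    by (subst P.nn_integral_fst[symmetric]) (simp_all cong: if_cong)
  finally show ?thesis .
qed

lemma (in product_prob_space) nn_integral_prod_coordinates:
  assumes "finite J" "J \<subseteq> I" and [measurable]: "\<And>j. j \<in> J \<Longrightarrow> h j \<in> borel_measurable (M j)"
  shows "(\<integral>\<^sup>+x. (\<Prod>j\<in>J. h j (x j)) \<partial>PiM I M) = (\<Prod>j\<in>J. \<integral>\<^sup>+x. h j x \<partial>M j)"
proof -
  have "(\<integral>\<^sup>+x. (\<Prod>j\<in>J. h j (x j)) \<partial>PiM I M) =
      (\<integral>\<^sup>+x. (\<Prod>j\<in>J. h j (restrict x J j)) \<partial>PiM I M)"
    by (auto intro!: nn_integral_cong prod.cong)
  also have "\<dots> = (\<integral>\<^sup>+x. (\<Prod>j\<in>J. h j (x j)) \<partial>PiM J M)"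
    using assms(1,2)
    by (subst distr_PiM_restrict_finite[symmetric, of J])
      (simp_all add: nn_integral_distr measurable_restrict_subset)
  also have "\<dots> = (\<Prod>j\<in>J. \<integral>\<^sup>+x. h j x \<partial>M j)"
    using assms(1) by (rule product_nn_integral_prod) simp
  finally show ?thesis .
qed

subsection \<open>The law of the receptions in one slot\<close>

declare One_nat_def [simp del]

text \<open>
  Reference measure for what one sensor delivers: Lebesgue measure on the observations of an
  awake sensor and a unit mass at the dummy value \<open>(False, 0)\<close> of a sleeping one. The indicator
  of the unit interval serves to turn Lebesgue measure into that unit mass.
\<close>

definition reception_base :: "(bool \<times> real) measure" where
  "reception_base =
     distr (density (count_space UNIV \<Otimes>\<^sub>M lborel)
         (\<lambda>(b, x). if b then 1 else indicator {0..1::real} x))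
       (count_space UNIV \<Otimes>\<^sub>M borel) (\<lambda>(b, x). if b then (True, x) else (False, 0))"

lemma sets_reception_base[measurable_cong]:
  "sets reception_base = sets (count_space UNIV \<Otimes>\<^sub>M borel)"
  by (simp add: reception_base_def)

lemma nn_integral_reception_base:
  assumes [measurable]: "h \<in> borel_measurable (count_space UNIV \<Otimes>\<^sub>M borel)"
  shows "(\<integral>\<^sup>+z. h z \<partial>reception_base) = (\<integral>\<^sup>+x. h (True, x) \<partial>lborel) + h (False, 0)"
proof -
  have [measurable]: "(\<lambda>(b, x). if b then (True, x) else (False, 0 :: real))
      \<in> measurable (count_space UNIV \<Otimes>\<^sub>M lborel) (count_space UNIV \<Otimes>\<^sub>M borel)"
    by measurable
  have "(\<integral>\<^sup>+z. h z \<partial>reception_base) =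
      (\<integral>\<^sup>+z. (case z of (b, x) \<Rightarrow> if b then 1 else indicator {0..1::real} x) *
         h (case z of (b, x) \<Rightarrow> if b then (True, x) else (False, 0)) \<partial>(count_space UNIV \<Otimes>\<^sub>M lborel))"
    by (simp add: reception_base_def nn_integral_distr nn_integral_density)
  also have "\<dots> = (\<integral>\<^sup>+b. \<integral>\<^sup>+x. (if b then 1 else indicator {0..1::real} x) *
         h (if b then (True, x) else (False, 0)) \<partial>lborel \<partial>count_space UNIV)"
    by (subst lborel.nn_integral_fst[symmetric]) (simp_all cong: if_cong)
  also have "\<dots> = (\<integral>\<^sup>+x. h (True, x) \<partial>lborel) + h (False, 0)"
    by (simp add: nn_integral_count_space_finite UNIV_bool nn_integral_multc add.commute)
  finally show ?thesis .
qed

text \<open>The boxes \<open>UNIV \<times> {-m..m}\<close> exhaust the space and have mass 2m + 1,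
  the 1 coming from the dummy value. Sigma-finiteness allows finite products of this measure and
  makes integrals against them measurable in a parameter.\<close>

lemma sigma_finite_reception_base: "sigma_finite_measure reception_base"
proof
  define A where "A = (\<lambda>m::nat. (UNIV :: bool set) \<times> {- real m..real m})"
  have A: "A m \<in> sets reception_base" for m
    by (simp add: A_def sets_reception_base)
  have "emeasure reception_base (A m) \<noteq> \<infinity>" for m
  proof -
    have "emeasure reception_base (A m) = (\<integral>\<^sup>+z. indicator (A m) z \<partial>reception_base)"
      using A by simp
    also have "\<dots> = (\<integral>\<^sup>+x. indicator {- real m..real m} x \<partial>lborel) + 1"
      using A[of m] unfolding sets_reception_base
      by (subst nn_integral_reception_base) (simp_all add: A_def indicator_times)
    finally show ?thesis by simp
  qed
  moreover have "(\<Union>m. A m) = space reception_base"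
  proof -
    have "\<exists>m. x \<in> {- real m..real m}" for x
      using real_arch_simple[of "\<bar>x\<bar>"] by (auto simp: abs_le_iff minus_le_iff)
    then show ?thesis
      by (auto simp: A_def sets_eq_imp_space_eq[OF sets_reception_base] space_pair_measure)
  qed
  ultimately show "\<exists>A. countable A \<and> A \<subseteq> sets reception_base \<and> \<Union> A = space reception_base \<and>
      (\<forall>a\<in>A. emeasure reception_base a \<noteq> \<infinity>)"
    using A by (intro exI[of _ "range A"]) auto
qed

interpretation reception_base: sigma_finite_measure reception_base
  by (rule sigma_finite_reception_base)

text \<open>Dominates the law of a whole slot for every change time and every awake probability at
  once, so that these enter only through densities.\<close>

definition reception_reference :: "nat \<Rightarrow> reception measure" where
  "reception_reference n = (\<Pi>\<^sub>M _ \<in> {1..n}. reception_base)"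

lemma sets_reception_reference[measurable_cong]:
  "sets (reception_reference n) = sets (reception_space n)"
  unfolding reception_reference_def reception_space_def
  by (intro sets_PiM_cong) (simp_all add: sets_reception_base)

lemma sigma_finite_reception_reference: "sigma_finite_measure (reception_reference n)"
proof -
  interpret product_sigma_finite "\<lambda>_::nat. reception_base" ..
  show ?thesis unfolding reception_reference_def by (rule sigma_finite) simp
qed

definition likelihood :: "nat \<Rightarrow> (real \<Rightarrow> real) \<Rightarrow> reception \<Rightarrow> real" where
  "likelihood n f r = (\<Prod>i\<in>{1..n}. if fst (r i) then f (snd (r i)) else 1)"

text \<open>Probability of the particular awake pattern shown by \<open>r\<close>. There is no
  binomial coefficient because the reception reveals which sensors are awake, not merely how
  many.\<close>

definition awake_weight :: "nat \<Rightarrow> real \<Rightarrow> reception \<Rightarrow> real" where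
  "awake_weight n q r = (\<Prod>i\<in>{1..n}. if fst (r i) then q else 1 - q)"

lemma measurable_reception_component[measurable (raw)]:
  assumes "g \<in> measurable M (reception_space n)" "i \<in> {1..n}"
  shows "(\<lambda>x. g x i) \<in> measurable M (count_space UNIV \<Otimes>\<^sub>M borel)"
  using measurable_compose[OF assms(1)[unfolded reception_space_def]
      measurable_component_singleton[OF assms(2)]] .

lemma measurable_likelihood[measurable]:
  assumes [measurable]: "f \<in> borel_measurable borel"
  shows "likelihood n f \<in> borel_measurable (reception_space n)"
  unfolding likelihood_def[abs_def] by measurable

lemma measurable_awake_weight[measurable]:
  "case_prod (awake_weight n) \<in> borel_measurable (borel \<Otimes>\<^sub>M reception_space n)"
  unfolding awake_weight_def[abs_def] by measurable

lemma likelihood_nonneg: "(\<And>x. 0 \<le> f x) \<Longrightarrow> 0 \<le> likelihood n f r"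
  by (auto simp: likelihood_def intro!: prod_nonneg)

lemma awake_weight_nonneg: "0 \<le> q \<Longrightarrow> q \<le> 1 \<Longrightarrow> 0 \<le> awake_weight n q r"
  by (auto simp: awake_weight_def intro!: prod_nonneg)

lemma prob_space_density_lborel: "prob_density f \<Longrightarrow> prob_space (density lborel f)"
  by (intro prob_spaceI) (simp add: prob_density_def emeasure_density)

lemma prob_space_uniform_unit: "prob_space (uniform_measure lborel {0..1::real})"
  by (rule prob_space_uniform_measure) simp_all

lemma nn_integral_unit_threshold:
  assumes q: "0 \<le> q" "q \<le> 1"
  shows "(\<integral>\<^sup>+u. (if u < q then a else b) \<partial>uniform_measure lborel {0..1::real}) =
    ennreal q * a + ennreal (1 - q) * b"
proof -
  have "(\<integral>\<^sup>+u. (if u < q then a else b) \<partial>uniform_measure lborel {0..1::real}) =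
      (\<integral>\<^sup>+u. (if u < q then a else b) * indicator {0..1::real} u \<partial>lborel)"
    by (subst nn_integral_uniform_measure) (simp_all add: divide_ennreal_def)
  also have "\<dots> = (\<integral>\<^sup>+u. a * indicator {0..<q} u + b * indicator {q..1} u \<partial>lborel)"
    using q by (intro nn_integral_cong) (auto simp: indicator_def)
  also have "\<dots> = ennreal q * a + ennreal (1 - q) * b"
    using q by (simp add: nn_integral_add nn_integral_cmult mult.commute)
  finally show ?thesis .
qed

lemma prob_space_single_reception:
  assumes f: "prob_density f" and q: "0 \<le> q" "q \<le> 1"
  shows "prob_space (density reception_base (\<lambda>(b, x). if b then q * f x else 1 - q))"
    (is "prob_space ?S")
proof -
  have [measurable]: "f \<in> borel_measurable borel" and f0: "0 \<le> f x" for x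
    using f by (auto simp: prob_density_def)
  have d[measurable]: "(\<lambda>z. ennreal (case z of (b, x) \<Rightarrow> if b then q * f x else 1 - q))
      \<in> borel_measurable reception_base"
    by (subst measurable_cong_sets[OF sets_reception_base refl]) measurable
  have S: "emeasure ?S UNIV = 1"
  proof -
    have "emeasure ?S UNIV = (\<integral>\<^sup>+z. (case z of (b, x) \<Rightarrow> if b then q * f x else 1 - q) \<partial>reception_base)"
      using sets.top[of "reception_base"] sets_eq_imp_space_eq[OF sets_reception_base]
      by (subst emeasure_density) (simp_all add: space_pair_measure)
    also have "\<dots> = 1"
      using f q f0 by (simp add: nn_integral_reception_base ennreal_mult' nn_integral_cmult
        prob_density_def ennreal_plus[symmetric] del: ennreal_plus)
    finally show ?thesis .
  qed
  show ?thesis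
    using S sets_eq_imp_space_eq[OF sets_reception_base]
    by (intro prob_spaceI) (simp add: space_pair_measure)
qed

text \<open>Likelihood and awake weight are both products over the sensors, so on rectangles the
  integral factorises into single-sensor laws, and rectangles determine a product measure.\<close>

lemma density_reception_reference:
  assumes f: "prob_density f" and q: "0 \<le> q" "q \<le> 1"
  shows "density (reception_reference n) (\<lambda>r. likelihood n f r * awake_weight n q r) =
    (\<Pi>\<^sub>M _\<in>{1..n}. density reception_base (\<lambda>(b, x). if b then q * f x else 1 - q))"
    (is "?P = PiM _ (\<lambda>_. ?S)")
proof -
  have [measurable]: "f \<in> borel_measurable borel" and f0: "0 \<le> f x" for x
    using f by (auto simp: prob_density_def)
  interpret B: product_sigma_finite "\<lambda>_::nat. reception_base" ..
  have d[measurable]: "(\<lambda>z. ennreal (case z of (b, x) \<Rightarrow> if b then q * f x else 1 - q))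
      \<in> borel_measurable reception_base"
    by (subst measurable_cong_sets[OF sets_reception_base refl]) measurable
  have d0: "0 \<le> (case z of (b, x) \<Rightarrow> if b then q * f x else 1 - q)" for z
    using q f0 by (auto split: prod.split)
  interpret S: prob_space ?S using assms by (rule prob_space_single_reception)
  interpret SS: product_sigma_finite "\<lambda>_::nat. ?S" ..
  show ?thesis
  proof (rule SS.PiM_eqI)
    show "sets ?P = sets (PiM {1..n} (\<lambda>_. ?S))"
      by (simp add: sets_reception_reference reception_space_def)
        (intro sets_PiM_cong, simp_all add: sets_reception_base)
    fix A :: "nat \<Rightarrow> _" assume "\<And>i. i \<in> {1..n} \<Longrightarrow> A i \<in> sets ?S"
    then have A[measurable]: "\<And>i. i \<in> {1..n} \<Longrightarrow> A i \<in> sets reception_base" by simp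
    have "Pi\<^sub>E {1..n} A \<in> sets (reception_reference n)"
      unfolding reception_reference_def using A by (intro sets_PiM_I_finite) auto
    then have "emeasure ?P (Pi\<^sub>E {1..n} A) =
        (\<integral>\<^sup>+r. ennreal (likelihood n f r * awake_weight n q r) * indicator (Pi\<^sub>E {1..n} A) r
          \<partial>reception_reference n)"
      by (intro emeasure_density) simp_all
    also have "\<dots> = (\<integral>\<^sup>+r. (\<Prod>i\<in>{1..n}. ennreal (case r i of (b, x) \<Rightarrow> if b then q * f x else 1 - q) *
        indicator (A i) (r i)) \<partial>reception_reference n)"
    proof (rule nn_integral_cong)
      fix r assume "r \<in> space (reception_reference n)"
      then have "r \<in> extensional {1..n}"
        by (simp add: reception_reference_def space_PiM PiE_def)
      then have "indicator (Pi\<^sub>E {1..n} A) r = (\<Prod>i\<in>{1..n}. indicator (A i) (r i) :: ennreal)"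
        by (simp add: prod_indicator_PiE)
      moreover have "likelihood n f r * awake_weight n q r =
          (\<Prod>i\<in>{1..n}. case r i of (b, x) \<Rightarrow> if b then q * f x else 1 - q)"
        unfolding likelihood_def awake_weight_def prod.distrib[symmetric]
        by (intro prod.cong) (auto split: prod.split)
      ultimately show "ennreal (likelihood n f r * awake_weight n q r) * indicator (Pi\<^sub>E {1..n} A) r =
          (\<Prod>i\<in>{1..n}. ennreal (case r i of (b, x) \<Rightarrow> if b then q * f x else 1 - q) *
            indicator (A i) (r i))"
        by (simp add: prod.distrib prod_ennreal d0)
    qed
    also have "\<dots> = (\<Prod>i\<in>{1..n}. \<integral>\<^sup>+z. ennreal (case z of (b, x) \<Rightarrow> if b then q * f x else 1 - q) *
        indicator (A i) z \<partial>reception_base)"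
      unfolding reception_reference_def
      by (rule B.product_nn_integral_prod) auto
    also have "\<dots> = (\<Prod>i\<in>{1..n}. emeasure ?S (A i))"
      by (intro prod.cong refl emeasure_density[symmetric]) auto
    finally show "emeasure ?P (Pi\<^sub>E {1..n} A) = (\<Prod>i\<in>{1..n}. emeasure ?S (A i))" .
  qed simp
qed

declare reception.simps [simp del]

lemma sets_observations_given[measurable_cong]:
  "sets (observations_given n f0 f1 t) = sets (PiM ({1..} \<times> {1..n}) (\<lambda>_. borel))"
  unfolding observations_given_def by (intro sets_PiM_cong) auto

lemma sets_awake_noise[measurable_cong]:
  "sets (awake_noise n) = sets (PiM ({1..} \<times> {1..n}) (\<lambda>_. borel))"
  unfolding awake_noise_def by (intro sets_PiM_cong) auto

lemma measurable_slot_component: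
  assumes "1 \<le> k" "i \<in> {1..n}"
  shows "(\<lambda>x. x (k, i)) \<in> borel_measurable (PiM ({1..} \<times> {1..n}) (\<lambda>_. borel))"
  using assms by (intro measurable_component_singleton) auto

lemma measurable_reception[measurable (raw)]:
  assumes k: "1 \<le> k" and [measurable]: "q \<in> borel_measurable M"
    "x \<in> measurable M (PiM ({1..} \<times> {1..n}) (\<lambda>_. borel))"
    "u \<in> measurable M (PiM ({1..} \<times> {1..n}) (\<lambda>_. borel))"
  shows "(\<lambda>\<omega>. reception n (q \<omega>) k (t, x \<omega>, u \<omega>)) \<in> measurable M (reception_space n)"
  unfolding reception.simps reception_space_def
proof (rule measurable_restrict)
  fix i assume i: "i \<in> {1..n}"
  have [measurable]: "(\<lambda>\<omega>. x \<omega> (k, i)) \<in> borel_measurable M" "(\<lambda>\<omega>. u \<omega> (k, i)) \<in> borel_measurable M"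
    using assms(3,4)[THEN measurable_compose, OF measurable_slot_component[OF k i]] .
  show "(\<lambda>\<omega>. if u \<omega> (k, i) < q \<omega> then (True, x \<omega> (k, i)) else (False, 0))
      \<in> measurable M (count_space UNIV \<Otimes>\<^sub>M borel)"
    by measurable
qed

lemma nn_integral_slot_prod:
  fixes n k :: nat
  assumes "product_prob_space M" and k: "1 \<le> k"
    and "\<And>i. i \<in> {1..n} \<Longrightarrow> h i \<in> borel_measurable (M (k, i))"
  shows "(\<integral>\<^sup>+x. (\<Prod>i\<in>{1..n}. h i (x (k, i))) \<partial>PiM ({1..} \<times> {1..n}) M) =
    (\<Prod>i\<in>{1..n}. \<integral>\<^sup>+x. h i x \<partial>M (k, i))"
proof -
  interpret product_prob_space M "{1..} \<times> {1..n}" by fact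
  have inj: "inj_on (Pair k) {1..n}" by (simp add: inj_on_def)
  have "(\<integral>\<^sup>+x. (\<Prod>j\<in>Pair k ` {1..n}. h (snd j) (x j)) \<partial>PiM ({1..} \<times> {1..n}) M) =
      (\<Prod>j\<in>Pair k ` {1..n}. \<integral>\<^sup>+x. h (snd j) x \<partial>M j)"
    using assms by (intro nn_integral_prod_coordinates finite_imageI) auto
  then show ?thesis by (simp add: prod.reindex[OF inj])
qed

locale sensor_densities =
  fixes n :: nat and f0 f1 :: "real \<Rightarrow> real"
  assumes f0: "prob_density f0" and f1: "prob_density f1"
begin

lemma measurable_densities[measurable]: "f0 \<in> borel_measurable borel" "f1 \<in> borel_measurable borel"
  and densities_nonneg: "0 \<le> f0 x" "0 \<le> f1 x"
  using f0 f1 by (auto simp: prob_density_def)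

definition slot_density :: "bool \<Rightarrow> real \<Rightarrow> real" where
  "slot_density changed = (if changed then f1 else f0)"

lemma prob_density_slot_density: "prob_density (slot_density c)"
  using f0 f1 by (simp add: slot_density_def)

lemma measurable_slot_density[measurable]: "slot_density c \<in> borel_measurable borel"
  and slot_density_nonneg: "0 \<le> slot_density c x"
  using prob_density_slot_density[of c] by (auto simp: prob_density_def)

abbreviation "obs \<equiv> observations_given n f0 f1"
abbreviation "noise \<equiv> awake_noise n"

lemma obs_eq: "obs t = PiM ({1..} \<times> {1..n}) (\<lambda>(k, i). density lborel (slot_density (t \<le> k)))"
  unfolding observations_given_def slot_density_def
  by (intro arg_cong2[where f=PiM] refl ext) (auto simp: not_less split: prod.split)

lemma product_prob_space_obs:
  "product_prob_space (\<lambda>(k, i). density lborel (slot_density (t \<le> k)))"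
proof -
  have "prob_space (case z of (k, i) \<Rightarrow> density lborel (slot_density (t \<le> k)))" for z
    using prob_space_density_lborel[OF prob_density_slot_density] by (cases z) simp
  then show ?thesis
    by (auto simp: product_prob_space_def product_prob_space_axioms_def product_sigma_finite_def
        intro: prob_space_imp_sigma_finite)
qed

lemma product_prob_space_noise: "product_prob_space (\<lambda>_::nat \<times> nat. uniform_measure lborel {0..1::real})"
  using prob_space_uniform_unit
  by (auto simp: product_prob_space_def product_prob_space_axioms_def product_sigma_finite_def
        intro: prob_space_imp_sigma_finite)

lemma prob_space_obs: "prob_space (obs t)"
proof -
  interpret product_prob_space "\<lambda>(k, i). density lborel (slot_density (t \<le> k))" "{1..} \<times> {1..n}"
    by (rule product_prob_space_obs)
  show ?thesis unfolding obs_eq by (rule prob_space_axioms)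
qed

lemma prob_space_noise: "prob_space noise"
  unfolding awake_noise_def by (rule prob_space_PiM) (rule prob_space_uniform_unit)

text \<open>Evaluated on rectangles. Integrating out the noise of slot \<open>k\<close> first turns
  each test \<open>u (k, i) < q\<close> into weights q and 1 - q; integrating the observations then
  gives one factor per sensor. The change time \<open>t'\<close> inside the sample is arbitrary
  because a reception does not read it; only \<open>t\<close>, which selects the law of the
  observations, matters.\<close>

lemma distr_reception:
  assumes k: "1 \<le> k" and q: "0 \<le> q" "q \<le> 1"
  shows "distr (obs t \<Otimes>\<^sub>M noise) (reception_space n) (\<lambda>z. reception n q k (t', z)) =
    density (reception_reference n) (\<lambda>r. likelihood n (slot_density (t \<le> k)) r * awake_weight n q r)"
    (is "?P = _")
proof -
  define f where "f = slot_density (t \<le> k)"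
  have f: "prob_density f" and [measurable]: "f \<in> borel_measurable borel"
    by (simp_all add: f_def prob_density_slot_density)
  let ?d = "\<lambda>(b, x). if b then q * f x else 1 - q"
  have d[measurable]: "(\<lambda>z. ennreal (?d z)) \<in> borel_measurable reception_base"
    by (subst measurable_cong_sets[OF sets_reception_base refl]) measurable
  interpret N: prob_space noise by (rule prob_space_noise)
  have R: "(\<lambda>(x, u). reception n q k (t', x, u)) \<in> measurable (obs t \<Otimes>\<^sub>M noise) (reception_space n)"
    using k by measurable
  have [measurable]: "(\<lambda>z. reception n q k (t', z)) \<in> measurable (obs t \<Otimes>\<^sub>M noise) (reception_space n)"
    using R by (simp add: case_prod_beta')
  interpret B: product_sigma_finite "\<lambda>_::nat. density reception_base ?d"
    using prob_space_single_reception[OF f q]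
    by (auto simp: product_sigma_finite_def intro: prob_space_imp_sigma_finite)
  have "?P = (\<Pi>\<^sub>M _\<in>{1..n}. density reception_base ?d)"
  proof (rule B.PiM_eqI)
    show "sets ?P = sets (PiM {1..n} (\<lambda>_. density reception_base ?d))"
      by (simp add: reception_space_def) (intro sets_PiM_cong, simp_all add: sets_reception_base)
    fix A :: "nat \<Rightarrow> _" assume "\<And>i. i \<in> {1..n} \<Longrightarrow> A i \<in> sets (density reception_base ?d)"
    then have A: "\<And>i. i \<in> {1..n} \<Longrightarrow> A i \<in> sets reception_base"
      and A'[measurable]: "\<And>i. i \<in> {1..n} \<Longrightarrow> A i \<in> sets (count_space UNIV \<Otimes>\<^sub>M borel)"
      by (simp_all add: sets_reception_base)
    have PA[measurable]: "Pi\<^sub>E {1..n} A \<in> sets (reception_space n)"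
      unfolding reception_space_def using A' by (intro sets_PiM_I_finite) auto
    have "emeasure ?P (Pi\<^sub>E {1..n} A) = (\<integral>\<^sup>+r. indicator (Pi\<^sub>E {1..n} A) r \<partial>?P)"
      by simp
    also have "\<dots> = (\<integral>\<^sup>+z. indicator (Pi\<^sub>E {1..n} A) (reception n q k (t', z)) \<partial>(obs t \<Otimes>\<^sub>M noise))"
      by (rule nn_integral_distr) simp_all
    also have "\<dots> = (\<integral>\<^sup>+x. \<integral>\<^sup>+u. indicator (Pi\<^sub>E {1..n} A) (reception n q k (t', x, u)) \<partial>noise \<partial>obs t)"
      by (subst N.nn_integral_fst[symmetric]) simp_all
    also have "\<dots> = (\<integral>\<^sup>+x. \<integral>\<^sup>+u. (\<Prod>i\<in>{1..n}. if u (k, i) < q then indicator (A i) (True, x (k, i))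
        else indicator (A i) (False, 0)) \<partial>noise \<partial>obs t)"
    proof (intro nn_integral_cong)
      fix x u
      have "(\<Prod>i\<in>{1..n}. if u (k, i) < q then indicator (A i) (True, x (k, i)) else indicator (A i) (False, 0)) =
          (\<Prod>i\<in>{1..n}. indicator (A i) (reception n q k (t', x, u) i) :: ennreal)"
        by (intro prod.cong) (auto simp: reception.simps)
      also have "\<dots> = indicator (Pi\<^sub>E {1..n} A) (reception n q k (t', x, u))"
        by (rule prod_indicator_PiE) (simp_all add: reception.simps extensional_def)
      finally show "indicator (Pi\<^sub>E {1..n} A) (reception n q k (t', x, u)) =
          (\<Prod>i\<in>{1..n}. if u (k, i) < q then indicator (A i) (True, x (k, i)) else indicator (A i) (False, 0) :: ennreal)"
        by simp
    qed
    also have "\<dots> = (\<integral>\<^sup>+x. (\<Prod>i\<in>{1..n}. ennreal q * indicator (A i) (True, x (k, i)) +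
        ennreal (1 - q) * indicator (A i) (False, 0)) \<partial>obs t)"
      unfolding awake_noise_def
      by (subst nn_integral_slot_prod[OF product_prob_space_noise k])
        (simp_all add: nn_integral_unit_threshold[OF q])
    also have "\<dots> = (\<Prod>i\<in>{1..n}. \<integral>\<^sup>+x. ennreal q * indicator (A i) (True, x) +
        ennreal (1 - q) * indicator (A i) (False, 0) \<partial>density lborel f)"
      unfolding obs_eq f_def
      by (subst nn_integral_slot_prod[OF product_prob_space_obs k]) simp_all
    also have "\<dots> = (\<Prod>i\<in>{1..n}. emeasure (density reception_base ?d) (A i))"
    proof (intro prod.cong refl)
      fix i assume i: "i \<in> {1..n}"
      have "(\<integral>\<^sup>+x. ennreal q * indicator (A i) (True, x) + ennreal (1 - q) * indicator (A i) (False, 0) \<partial>density lborel f) =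
        (\<integral>\<^sup>+x. ennreal q * indicator (A i) (True, x) \<partial>density lborel f) + ennreal (1 - q) * indicator (A i) (False, 0)"
        using i prob_space.emeasure_space_1[OF prob_space_density_lborel[OF f]]
        by (subst nn_integral_add) simp_all
      also have "\<dots> = (\<integral>\<^sup>+x. ennreal (q * f x) * indicator (A i) (True, x) \<partial>lborel) + ennreal (1 - q) * indicator (A i) (False, 0)"
        using i q by (subst nn_integral_density)
         (auto simp: ennreal_mult' mult_ac f_def slot_density_nonneg)
      also have "\<dots> = (\<integral>\<^sup>+z. ennreal (?d z) * indicator (A i) z \<partial>reception_base)"
        using i by (subst nn_integral_reception_base) auto
      also have "\<dots> = emeasure (density reception_base ?d) (A i)"
        using A[OF i] by (simp add: emeasure_density)
      finally show "(\<integral>\<^sup>+x. ennreal q * indicator (A i) (True, x) + ennreal (1 - q) * indicator (A i) (False, 0) \<partial>density lborel f) =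
        emeasure (density reception_base ?d) (A i)" .
    qed
    finally show "emeasure ?P (Pi\<^sub>E {1..n} A) = (\<Prod>i\<in>{1..n}. emeasure (density reception_base ?d) (A i))" .
  qed simp
  then show ?thesis
    unfolding f_def[symmetric] using density_reception_reference[OF f q] by simp
qed

end

subsection \<open>Dynamics of the information\<close>

lemma space_action_space: "space action_space = {(True, 0)} \<union> {False} \<times> {0..1}"
  by (auto simp: action_space_def space_restrict_space space_pair_measure)

lemma measurable_action:
  assumes "a \<in> measurable M action_space"
  shows "a \<in> measurable M (count_space UNIV \<Otimes>\<^sub>M borel)"
  using assms by (simp add: action_space_def measurable_restrict_space2_iff)

lemma measurable_action_components[measurable (raw)]:
  assumes "a \<in> measurable M action_space"
  shows "(\<lambda>x. fst (a x)) \<in> measurable M (count_space UNIV)"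
    and "(\<lambda>x. snd (a x)) \<in> borel_measurable M"
  using measurable_compose[OF measurable_action[OF assms] measurable_fst]
    measurable_compose[OF measurable_action[OF assms] measurable_snd] by simp_all

definition extend_info :: "nat \<Rightarrow> info \<Rightarrow> reception \<Rightarrow> action \<Rightarrow> info" where
  "extend_info k I r a = ((fst I)(Suc k := r), (snd I)(k := a))"

declare info.simps(2) [simp del]

lemma info_Suc: "info n A (Suc k) \<omega> = extend_info k (info n A k \<omega>)
    (reception n (snd (A k (info n A k \<omega>))) (Suc k) \<omega>) (A k (info n A k \<omega>))"
  by (simp add: info.simps extend_info_def Let_def)

lemma measurable_extend_info[measurable (raw)]:
  assumes f: "f \<in> measurable M (info_space n k)" and g: "g \<in> measurable M (reception_space n)"
    and h: "h \<in> measurable M action_space"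
  shows "(\<lambda>x. extend_info k (f x) (g x) (h x)) \<in> measurable M (info_space n (Suc k))"
  unfolding extend_info_def info_space_def
  by (intro measurable_Pair measurable_fun_upd[where J="{1..k}"] measurable_fun_upd[where J="{..<k}"] g h)
    (use measurable_compose[OF f[unfolded info_space_def] measurable_fst]
         measurable_compose[OF f[unfolded info_space_def] measurable_snd] in auto)

lemma measurable_info[measurable (raw)]:
  assumes B: "admissible n B"
    and [measurable]: "x \<in> measurable M (PiM ({1..} \<times> {1..n}) (\<lambda>_. borel))"
    "u \<in> measurable M (PiM ({1..} \<times> {1..n}) (\<lambda>_. borel))"
  shows "(\<lambda>\<omega>. info n B k (t, x \<omega>, u \<omega>)) \<in> measurable M (info_space n k)"
proof (induction k)
  case 0
  show ?case by (auto simp: info_space_def space_pair_measure space_PiM)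
next
  case (Suc k)
  note [measurable] = Suc
  have [measurable]: "B k \<in> measurable (info_space n k) action_space"
    using B by (simp add: admissible_def)
  show ?case unfolding info_Suc by measurable
qed

lemma info_in_space:
  assumes "admissible n B" "x \<in> space (PiM ({1..} \<times> {1..n}) (\<lambda>_. borel))"
    "u \<in> space (PiM ({1..} \<times> {1..n}) (\<lambda>_. borel))"
  shows "info n B k (t, x, u) \<in> space (info_space n k)"
  using measurable_info[OF assms(1), of "\<lambda>_. x" "count_space UNIV" "\<lambda>_. u"] assms(2,3)
  by (auto simp: Pi_iff)

text \<open>Receptions read neither the change time nor later slots. This is what allows slot
  \<open>k + 1\<close> to be resampled, or the change time to be replaced, without disturbing the
  past.\<close>

lemma info_cong:
  assumes "\<And>j i. 1 \<le> j \<Longrightarrow> j \<le> k \<Longrightarrow> i \<in> {1..n} \<Longrightarrow> x (j, i) = x' (j, i) \<and> u (j, i) = u' (j, i)"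
  shows "info n B k (t, x, u) = info n B k (t', x', u')"
  using assms
proof (induction k)
  case (Suc k)
  have "info n B k (t, x, u) = info n B k (t', x', u')" by (rule Suc.IH) (simp add: Suc.prems)
  moreover have "reception n q (Suc k) (t, x, u) = reception n q (Suc k) (t', x', u')" for q
    using Suc.prems[of "Suc k"] by (auto simp: reception.simps intro!: restrict_ext)
  ultimately show ?case by (simp add: info_Suc)
qed simp

context sensor_densities
begin

lemmas space_obs = sets_eq_imp_space_eq[OF sets_observations_given[of n f0 f1]]

lemmas space_noise = sets_eq_imp_space_eq[OF sets_awake_noise]

lemma nn_integral_reception:
  assumes k: "1 \<le> k" and q: "0 \<le> q" "q \<le> 1"
    and [measurable]: "G \<in> borel_measurable (reception_space n)"
  shows "(\<integral>\<^sup>+x. \<integral>\<^sup>+u. G (reception n q k (t', x, u)) \<partial>noise \<partial>obs t) =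
    (\<integral>\<^sup>+r. ennreal (likelihood n (slot_density (t \<le> k)) r * awake_weight n q r) * G r
      \<partial>reception_reference n)"
proof -
  interpret N: prob_space noise by (rule prob_space_noise)
  have "(\<lambda>(x, u). reception n q k (t', x, u)) \<in> measurable (obs t \<Otimes>\<^sub>M noise) (reception_space n)"
    using k by measurable
  then have [measurable]: "(\<lambda>z. reception n q k (t', z)) \<in> measurable (obs t \<Otimes>\<^sub>M noise) (reception_space n)"
    by (simp add: case_prod_beta')
  have "(\<integral>\<^sup>+x. \<integral>\<^sup>+u. G (reception n q k (t', x, u)) \<partial>noise \<partial>obs t) =
      (\<integral>\<^sup>+z. G (reception n q k (t', z)) \<partial>(obs t \<Otimes>\<^sub>M noise))"
    by (subst N.nn_integral_fst[symmetric]) simp_all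
  also have "\<dots> = (\<integral>\<^sup>+r. G r \<partial>distr (obs t \<Otimes>\<^sub>M noise) (reception_space n) (\<lambda>z. reception n q k (t', z)))"
    by (subst nn_integral_distr) simp_all
  also have "\<dots> = (\<integral>\<^sup>+r. ennreal (likelihood n (slot_density (t \<le> k)) r * awake_weight n q r) * G r
      \<partial>reception_reference n)"
    unfolding distr_reception[OF k q] by (subst nn_integral_density) simp_all
  finally show ?thesis .
qed

lemma nn_integral_obs_copy:
  assumes "F \<in> borel_measurable (obs t)"
  shows "(\<integral>\<^sup>+x. F x \<partial>obs t) =
    (\<integral>\<^sup>+x. \<integral>\<^sup>+y. F (\<lambda>i\<in>{1..} \<times> {1..n}. if i \<in> C then y i else x i) \<partial>obs t \<partial>obs t)"
proof -
  interpret product_prob_space "\<lambda>(k, i). density lborel (slot_density (t \<le> k))" "{1..} \<times> {1..n}"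
    by (rule product_prob_space_obs)
  show ?thesis using assms unfolding obs_eq by (rule nn_integral_merge_copy)
qed

lemma nn_integral_noise_copy:
  assumes "F \<in> borel_measurable noise"
  shows "(\<integral>\<^sup>+u. F u \<partial>noise) =
    (\<integral>\<^sup>+u. \<integral>\<^sup>+v. F (\<lambda>i\<in>{1..} \<times> {1..n}. if i \<in> C then v i else u i) \<partial>noise \<partial>noise)"
proof -
  interpret product_prob_space "\<lambda>_::nat \<times> nat. uniform_measure lborel {0..1::real}" "{1..} \<times> {1..n}"
    by (rule product_prob_space_noise)
  show ?thesis using assms unfolding awake_noise_def by (rule nn_integral_merge_copy)
qed

text \<open>The coordinates of slot \<open>Suc k\<close> are replaced by fresh copies
  \<open>y\<close> and \<open>v\<close>. The information up to \<open>k\<close> then depends on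
  \<open>x\<close> and \<open>u\<close> only, and the new reception on \<open>y\<close> and
  \<open>v\<close> only, so the awake probability chosen from the past is a constant for the inner
  integrals.\<close>

lemma nn_integral_info_Suc:
  assumes B: "admissible n B" and [measurable]: "G \<in> borel_measurable (info_space n (Suc k))"
  shows "(\<integral>\<^sup>+x. \<integral>\<^sup>+u. G (info n B (Suc k) (t, x, u)) \<partial>noise \<partial>obs t) =
    (\<integral>\<^sup>+x. \<integral>\<^sup>+u. (let I = info n B k (t, x, u) in
       \<integral>\<^sup>+r. ennreal (likelihood n (slot_density (t \<le> Suc k)) r * awake_weight n (snd (B k I)) r) *
         G (extend_info k I r (B k I)) \<partial>reception_reference n) \<partial>noise \<partial>obs t)"
proof -
  interpret N: prob_space noise by (rule prob_space_noise)
  interpret O: prob_space "obs t" by (rule prob_space_obs)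
  interpret pair_sigma_finite "obs t" noise ..
  have Bk[measurable]: "B k \<in> measurable (info_space n k) action_space"
    using B by (simp add: admissible_def)
  note [measurable] = measurable_info[OF B]
  let ?C = "{Suc k} \<times> {1..n}"
  let ?m = "\<lambda>x y. \<lambda>i\<in>{1..} \<times> {1..n}. if i \<in> ?C then y i else x i"
  let ?G = "\<lambda>x u y v. G (extend_info k (info n B k (t, x, u))
      (reception n (snd (B k (info n B k (t, x, u)))) (Suc k) (t, y, v)) (B k (info n B k (t, x, u))))"
  have m: "G (info n B (Suc k) (t, ?m x y, ?m u v)) = ?G x u y v" for x u y v
  proof -
    have "info n B k (t, ?m x y, ?m u v) = info n B k (t, x, u)"
      by (rule info_cong) auto
    moreover have "reception n q (Suc k) (t, ?m x y, ?m u v) = reception n q (Suc k) (t, y, v)" for q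
      by (auto simp: reception.simps intro!: restrict_ext)
    ultimately show ?thesis by (simp add: info_Suc)
  qed
  have "(\<integral>\<^sup>+x. \<integral>\<^sup>+u. G (info n B (Suc k) (t, x, u)) \<partial>noise \<partial>obs t) =
      (\<integral>\<^sup>+x. \<integral>\<^sup>+u. \<integral>\<^sup>+v. G (info n B (Suc k) (t, x, ?m u v)) \<partial>noise \<partial>noise \<partial>obs t)"
  proof (rule nn_integral_cong, rule nn_integral_noise_copy)
    fix x assume "x \<in> space (obs t)"
    then have [measurable]: "x \<in> space (PiM ({1..} \<times> {1..n}) (\<lambda>_. borel))"
      by (simp add: space_obs)
    show "(\<lambda>u. G (info n B (Suc k) (t, x, u))) \<in> borel_measurable noise" by measurable
  qed
  also have "\<dots> = (\<integral>\<^sup>+x. \<integral>\<^sup>+y. \<integral>\<^sup>+u. \<integral>\<^sup>+v. G (info n B (Suc k) (t, ?m x y, ?m u v)) \<partial>noise \<partial>noise \<partial>obs t \<partial>obs t)"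
    by (rule nn_integral_obs_copy) simp
  also have "\<dots> = (\<integral>\<^sup>+x. \<integral>\<^sup>+y. \<integral>\<^sup>+u. \<integral>\<^sup>+v. ?G x u y v \<partial>noise \<partial>noise \<partial>obs t \<partial>obs t)"
    unfolding m ..
  \<comment> \<open>The old noise \<open>u\<close> is exchanged with the fresh observations
    \<open>y\<close>, so that everything that determines the past stands outside and the inner
    double integral is the law of one reception.\<close>
  also have "\<dots> = (\<integral>\<^sup>+x. \<integral>\<^sup>+u. \<integral>\<^sup>+y. \<integral>\<^sup>+v. ?G x u y v \<partial>noise \<partial>obs t \<partial>noise \<partial>obs t)"
  proof (rule nn_integral_cong, rule Fubini'[symmetric])
    fix x assume "x \<in> space (obs t)"
    then have [measurable]: "x \<in> space (PiM ({1..} \<times> {1..n}) (\<lambda>_. borel))"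
      by (simp add: space_obs)
    show "(\<lambda>(y, u). \<integral>\<^sup>+v. ?G x u y v \<partial>noise) \<in> borel_measurable (obs t \<Otimes>\<^sub>M noise)"
      by measurable
  qed
  also have "\<dots> = (\<integral>\<^sup>+x. \<integral>\<^sup>+u. (let I = info n B k (t, x, u) in
       \<integral>\<^sup>+r. ennreal (likelihood n (slot_density (t \<le> Suc k)) r * awake_weight n (snd (B k I)) r) *
         G (extend_info k I r (B k I)) \<partial>reception_reference n) \<partial>noise \<partial>obs t)"
  proof (intro nn_integral_cong)
    fix x u assume xu: "x \<in> space (obs t)" "u \<in> space noise"
    define I where "I = info n B k (t, x, u)"
    have I[measurable]: "I \<in> space (info_space n k)"
      using xu unfolding I_def
      by (intro info_in_space[OF B]) (simp_all add: space_obs space_noise)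
    have BI: "B k I \<in> space action_space"
      using measurable_space[OF Bk I] .
    then have "0 \<le> snd (B k I)" "snd (B k I) \<le> 1"
      by (auto simp: space_action_space)
    then show "(\<integral>\<^sup>+y. \<integral>\<^sup>+v. ?G x u y v \<partial>noise \<partial>obs t) = (let I = info n B k (t, x, u) in
       \<integral>\<^sup>+r. ennreal (likelihood n (slot_density (t \<le> Suc k)) r * awake_weight n (snd (B k I)) r) *
         G (extend_info k I r (B k I)) \<partial>reception_reference n)"
      unfolding Let_def I_def[symmetric] using BI I
      by (intro nn_integral_reception) simp_all
  qed
  finally show ?thesis .
qed

end

section \<open>The law of a sample point and of the information under a random change time\<close>

locale sensor_problem = sensor_densities +
  fixes \<rho> p :: real
  assumes p_pos: "0 < p" and p_le_1: "p \<le> 1" and rho_nonneg: "0 \<le> \<rho>" and rho_le_1: "\<rho> \<le> 1"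
begin

abbreviation "M \<equiv> sensor_measure n \<rho> p f0 f1"

abbreviation "slots \<equiv> PiM ({1..} \<times> {1..n}) (\<lambda>_::nat \<times> nat. borel :: real measure)"

lemma emeasure_change_time_greater:
  "emeasure (change_time_pmf \<rho> p) {t. k < t} = ennreal ((1 - \<rho>) * (1 - p) ^ k)"
proof -
  have "measure (change_time_pmf \<rho> p) {t. k < t} = (1 - \<rho>) * (1 - p) ^ k"
  proof (induction k)
    case 0
    have "measure (change_time_pmf \<rho> p) {t. 0 < t} = 1 - measure (change_time_pmf \<rho> p) {0}"
      by (subst measure_pmf.prob_compl[symmetric]) (auto intro!: arg_cong[where f="measure _"])
    then show ?case using rho_nonneg rho_le_1
      by (simp add: measure_pmf_single pmf_change_time_0)
  next
    case (Suc k)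
    have "measure (change_time_pmf \<rho> p) {t. k < t} =
        measure (change_time_pmf \<rho> p) ({Suc k} \<union> {t. Suc k < t})"
      by (rule arg_cong[where f="measure _"]) auto
    also have "\<dots> = pmf (change_time_pmf \<rho> p) (Suc k) + measure (change_time_pmf \<rho> p) {t. Suc k < t}"
      by (subst measure_pmf.finite_measure_Union) (simp_all add: measure_pmf_single)
    finally have "measure (change_time_pmf \<rho> p) {t. k < t} =
        pmf (change_time_pmf \<rho> p) (Suc k) + measure (change_time_pmf \<rho> p) {t. Suc k < t}" .
    then show ?case
      using Suc rho_nonneg rho_le_1 p_pos p_le_1
      by (simp add: pmf_change_time_Suc algebra_simps)
  qed
  then show ?thesis by (simp add: measure_pmf.emeasure_eq_measure)
qed

text \<open>The constant hazard rate of the geometric law: of the mass beyond \<open>k\<close>, the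
  fraction p sits at \<open>Suc k\<close>. This is the source of the prediction step of the
  filter.\<close>

lemma emeasure_change_time_Suc:
  "emeasure (change_time_pmf \<rho> p) {Suc k} = ennreal p * ennreal ((1 - \<rho>) * (1 - p) ^ k)"
  using rho_nonneg rho_le_1 p_pos p_le_1
  by (simp add: emeasure_pmf_single pmf_change_time_Suc ennreal_mult'[symmetric] mult_ac)

text \<open>The change time is discrete, so every map of it is measurable; all that has to be
  checked is that each value is a subprobability measure on the same sigma-algebra.\<close>

lemma kernel_sensor_measure:
  "(\<lambda>t. return (count_space UNIV) t \<Otimes>\<^sub>M (obs t \<Otimes>\<^sub>M noise))
    \<in> measurable (measure_pmf (change_time_pmf \<rho> p))
        (subprob_algebra (count_space UNIV \<Otimes>\<^sub>M (slots \<Otimes>\<^sub>M slots)))"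
proof -
  have "return (count_space UNIV) t \<Otimes>\<^sub>M (obs t \<Otimes>\<^sub>M noise)
      \<in> space (subprob_algebra (count_space UNIV \<Otimes>\<^sub>M (slots \<Otimes>\<^sub>M slots)))" for t :: nat
  proof -
    interpret O: prob_space "obs t" by (rule prob_space_obs)
    interpret N: prob_space noise by (rule prob_space_noise)
    interpret ON: pair_prob_space "obs t" noise ..
    interpret R: prob_space "return (count_space UNIV) t" by (rule prob_space_return) simp
    interpret RON: pair_prob_space "return (count_space UNIV) t" "obs t \<Otimes>\<^sub>M noise" ..
    show ?thesis
      by (auto simp: space_subprob_algebra RON.subprob_space_axioms
          intro!: sets_pair_measure_cong sets_observations_given sets_awake_noise)
  qed
  then show ?thesis by (simp add: Pi_iff)
qed

lemma sets_sensor_measure[measurable_cong]: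
  "sets M = sets (count_space UNIV \<Otimes>\<^sub>M (slots \<Otimes>\<^sub>M slots))"
  unfolding sensor_measure_def by (rule sets_bind[OF sets_kernel[OF kernel_sensor_measure]]) auto

lemma prob_space_sensor_measure: "prob_space M"
  unfolding sensor_measure_def
proof (rule measure_pmf.prob_space_bind[OF _ kernel_sensor_measure], rule AE_I2)
  fix t
  interpret O: prob_space "obs t" by (rule prob_space_obs)
  interpret N: prob_space noise by (rule prob_space_noise)
  interpret ON: pair_prob_space "obs t" noise ..
  interpret R: prob_space "return (count_space UNIV) t" by (rule prob_space_return) simp
  interpret RON: pair_prob_space "return (count_space UNIV) t" "obs t \<Otimes>\<^sub>M noise" ..
  show "prob_space (return (count_space UNIV) t \<Otimes>\<^sub>M (obs t \<Otimes>\<^sub>M noise))"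
    by (rule RON.prob_space_axioms)
qed

lemma nn_integral_sensor_measure:
  assumes [measurable]: "F \<in> borel_measurable M"
  shows "(\<integral>\<^sup>+\<omega>. F \<omega> \<partial>M) =
    (\<integral>\<^sup>+t. \<integral>\<^sup>+x. \<integral>\<^sup>+u. F (t, x, u) \<partial>noise \<partial>obs t \<partial>measure_pmf (change_time_pmf \<rho> p))"
proof -
  have [measurable]: "F \<in> borel_measurable (count_space UNIV \<Otimes>\<^sub>M (slots \<Otimes>\<^sub>M slots))"
    using assms by (simp add: measurable_cong_sets[OF sets_sensor_measure refl])
  have "(\<integral>\<^sup>+\<omega>. F \<omega> \<partial>M) =
      (\<integral>\<^sup>+t. \<integral>\<^sup>+\<omega>. F \<omega> \<partial>(return (count_space UNIV) t \<Otimes>\<^sub>M (obs t \<Otimes>\<^sub>M noise)) \<partial>change_time_pmf \<rho> p)"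
    unfolding sensor_measure_def by (rule nn_integral_bind[OF _ kernel_sensor_measure]) simp
  also have "\<dots> = (\<integral>\<^sup>+t. \<integral>\<^sup>+x. \<integral>\<^sup>+u. F (t, x, u) \<partial>noise \<partial>obs t \<partial>change_time_pmf \<rho> p)"
  proof (rule nn_integral_cong)
    fix t
    interpret O: prob_space "obs t" by (rule prob_space_obs)
    interpret N: prob_space noise by (rule prob_space_noise)
    interpret ON: pair_prob_space "obs t" noise ..
    have [measurable]: "F \<in> borel_measurable (return (count_space UNIV) t \<Otimes>\<^sub>M (obs t \<Otimes>\<^sub>M noise))"
      by (subst measurable_cong_sets[OF sets_pair_measure_cong[OF sets_return refl] refl]) simp
    have "(\<integral>\<^sup>+\<omega>. F \<omega> \<partial>(return (count_space UNIV) t \<Otimes>\<^sub>M (obs t \<Otimes>\<^sub>M noise))) =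
        (\<integral>\<^sup>+s. \<integral>\<^sup>+z. F (s, z) \<partial>(obs t \<Otimes>\<^sub>M noise) \<partial>return (count_space UNIV) t)"
      by (subst ON.nn_integral_fst) simp_all
    also have "\<dots> = (\<integral>\<^sup>+z. F (t, z) \<partial>(obs t \<Otimes>\<^sub>M noise))"
      by (subst nn_integral_return) simp_all
    also have "\<dots> = (\<integral>\<^sup>+x. \<integral>\<^sup>+u. F (t, x, u) \<partial>noise \<partial>obs t)"
      by (subst N.nn_integral_fst[symmetric]) simp_all
    finally show "(\<integral>\<^sup>+\<omega>. F \<omega> \<partial>(return (count_space UNIV) t \<Otimes>\<^sub>M (obs t \<Otimes>\<^sub>M noise))) =
        (\<integral>\<^sup>+x. \<integral>\<^sup>+u. F (t, x, u) \<partial>noise \<partial>obs t)" .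
  qed
  finally show ?thesis .
qed

lemma measurable_info_sensor_measure[measurable (raw)]:
  assumes B: "admissible n B"
  shows "info n B k \<in> measurable M (info_space n k)"
proof -
  \<comment> \<open>The information does not read the change time, which may be frozen at 0;
    measurability in the other two components then suffices.\<close>
  have "info n B k \<omega> = info n B k (0, fst (snd \<omega>), snd (snd \<omega>))" for \<omega>
    by (cases \<omega>) (auto intro!: info_cong)
  then have *: "info n B k = (\<lambda>\<omega>. info n B k (0, fst (snd \<omega>), snd (snd \<omega>)))" by auto
  note [measurable] = measurable_info[OF B]
  show ?thesis by (subst *) measurable
qed

text \<open>Expectation of \<open>g\<close> of the information at time \<open>k\<close>, given that
  the change time is \<open>t\<close>.\<close>

definition conditional_law :: "policy \<Rightarrow> nat \<Rightarrow> (info \<Rightarrow> ennreal) \<Rightarrow> nat \<Rightarrow> ennreal" where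
  "conditional_law B k g t = (\<integral>\<^sup>+x. \<integral>\<^sup>+u. g (info n B k (t, x, u)) \<partial>noise \<partial>obs t)"

text \<open>One-step transition operator of the information. The density \<open>d\<close> is left
  free so that the same operator serves for the laws before and after the change, for their mixture,
  and for unnormalised posterior weights.\<close>

definition observe :: "policy \<Rightarrow> nat \<Rightarrow> (info \<Rightarrow> reception \<Rightarrow> real) \<Rightarrow> (info \<Rightarrow> ennreal) \<Rightarrow> info \<Rightarrow> ennreal" where
  "observe B k d g I =
     (\<integral>\<^sup>+r. ennreal (d I r * awake_weight n (snd (B k I)) r) * g (extend_info k I r (B k I))
       \<partial>reception_reference n)"

lemma measurable_observe[measurable (raw)]:
  assumes B: "admissible n B" and [measurable]: "g \<in> borel_measurable (info_space n (Suc k))"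
    "case_prod d \<in> borel_measurable (info_space n k \<Otimes>\<^sub>M reception_space n)"
  shows "observe B k d g \<in> borel_measurable (info_space n k)"
proof -
  interpret R: sigma_finite_measure "reception_reference n" by (rule sigma_finite_reception_reference)
  have [measurable]: "B k \<in> measurable (info_space n k) action_space"
    using B by (simp add: admissible_def)
  show ?thesis unfolding observe_def[abs_def] by measurable
qed

lemma conditional_law_Suc:
  assumes B: "admissible n B" and g: "g \<in> borel_measurable (info_space n (Suc k))"
  shows "conditional_law B (Suc k) g t =
    conditional_law B k (observe B k (\<lambda>_. likelihood n (slot_density (t \<le> Suc k))) g) t"
  using nn_integral_info_Suc[OF assms, of t] by (simp add: conditional_law_def observe_def Let_def)

text \<open>If the change comes after \<open>k\<close>, all slots up to \<open>k\<close> use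
  \<open>f0\<close>, so the transition operators in the induction are the same for \<open>t\<close>
  and \<open>t'\<close>.\<close>

lemma conditional_law_before_change:
  assumes B: "admissible n B" and g: "g \<in> borel_measurable (info_space n k)" and "k < t" "k < t'"
  shows "conditional_law B k g t = conditional_law B k g t'"
  using g \<open>k < t\<close> \<open>k < t'\<close>
proof (induction k arbitrary: g)
  case 0
  then show ?case
    by (simp add: conditional_law_def prob_space.emeasure_space_1[OF prob_space_obs]
        prob_space.emeasure_space_1[OF prob_space_noise])
next
  case (Suc k)
  have "observe B k (\<lambda>_. likelihood n (slot_density False)) g \<in> borel_measurable (info_space n k)"
    by (intro measurable_observe B Suc.prems(1)) simp
  from Suc.IH[OF this] show ?case
    using Suc.prems by (simp add: conditional_law_Suc[OF B])
qed

lemma nn_integral_info: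
  assumes B: "admissible n B" and [measurable]: "g \<in> borel_measurable (info_space n k)"
  shows "(\<integral>\<^sup>+\<omega>. indicator S (fst \<omega>) * g (info n B k \<omega>) \<partial>M) =
    (\<integral>\<^sup>+t. indicator S t * conditional_law B k g t \<partial>measure_pmf (change_time_pmf \<rho> p))"
proof -
  note [measurable] = measurable_info[OF B] measurable_info_sensor_measure[OF B]
  interpret N: prob_space noise by (rule prob_space_noise)
  have "(\<integral>\<^sup>+x. \<integral>\<^sup>+u. indicator S t * g (info n B k (t, x, u)) \<partial>noise \<partial>obs t) =
      indicator S t * conditional_law B k g t" for t
    by (cases "t \<in> S") (simp_all add: conditional_law_def)
  then show ?thesis
    by (subst nn_integral_sensor_measure) simp_all
qed

text \<open>The change times are restricted to \<open>{..Suc k}\<close> on both sides, although the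
  right-hand side only uses the information at time \<open>k\<close>: a change at
  \<open>Suc k\<close> already governs the observations of slot \<open>Suc k\<close>.\<close>

lemma nn_integral_info_Suc_after_change:
  assumes B: "admissible n B" and [measurable]: "g \<in> borel_measurable (info_space n (Suc k))"
  shows "(\<integral>\<^sup>+\<omega>. indicator {..Suc k} (fst \<omega>) * g (info n B (Suc k) \<omega>) \<partial>M) =
    (\<integral>\<^sup>+\<omega>. indicator {..Suc k} (fst \<omega>) * observe B k (\<lambda>_. likelihood n f1) g (info n B k \<omega>) \<partial>M)"
  using B
  by (subst (1 2) nn_integral_info)
    (auto simp: conditional_law_Suc slot_density_def indicator_def
      intro!: nn_integral_cong measurable_observe)

lemma nn_integral_info_Suc_before_change:
  assumes B: "admissible n B" and [measurable]: "g \<in> borel_measurable (info_space n (Suc k))"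
  shows "(\<integral>\<^sup>+\<omega>. indicator {Suc k<..} (fst \<omega>) * g (info n B (Suc k) \<omega>) \<partial>M) =
    (\<integral>\<^sup>+\<omega>. indicator {Suc k<..} (fst \<omega>) * observe B k (\<lambda>_. likelihood n f0) g (info n B k \<omega>) \<partial>M)"
  using B
  by (subst (1 2) nn_integral_info)
    (auto simp: conditional_law_Suc slot_density_def indicator_def
      intro!: nn_integral_cong measurable_observe)

text \<open>As long as the change has not happened, what was received is independent of the change time.\<close>

lemma nn_integral_info_not_yet_changed:
  assumes B: "admissible n B" and [measurable]: "g \<in> borel_measurable (info_space n k)"
    and S: "S \<subseteq> {k<..}"
  shows "(\<integral>\<^sup>+\<omega>. indicator S (fst \<omega>) * g (info n B k \<omega>) \<partial>M) =
    emeasure (change_time_pmf \<rho> p) S * conditional_law B k g (Suc k)"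
proof -
  have "indicator S t * conditional_law B k g t = indicator S t * conditional_law B k g (Suc k)" for t
    using S conditional_law_before_change[OF B assms(2), of t "Suc k"] by (auto simp: indicator_def)
  then show ?thesis
    by (subst nn_integral_info[OF B assms(2)]) (simp add: nn_integral_multc)
qed

text \<open>Both events lie inside the event that the change comes after \<open>k\<close>, on which
  the information is independent of the change time. Hence only the ratios p and 1 - p of the masses
  count, and the product form also covers the case of zero mass.\<close>

lemma nn_integral_info_change_next:
  assumes B: "admissible n B" and g: "g \<in> borel_measurable (info_space n k)"
  shows "(\<integral>\<^sup>+\<omega>. indicator {Suc k} (fst \<omega>) * g (info n B k \<omega>) \<partial>M) =
      ennreal p * (\<integral>\<^sup>+\<omega>. indicator {k<..} (fst \<omega>) * g (info n B k \<omega>) \<partial>M)"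
    and "(\<integral>\<^sup>+\<omega>. indicator {Suc k<..} (fst \<omega>) * g (info n B k \<omega>) \<partial>M) =
      ennreal (1 - p) * (\<integral>\<^sup>+\<omega>. indicator {k<..} (fst \<omega>) * g (info n B k \<omega>) \<partial>M)"
proof -
  have [simp]: "{k<..} = {t. k < t}" for k :: nat by auto
  show "(\<integral>\<^sup>+\<omega>. indicator {Suc k} (fst \<omega>) * g (info n B k \<omega>) \<partial>M) =
      ennreal p * (\<integral>\<^sup>+\<omega>. indicator {k<..} (fst \<omega>) * g (info n B k \<omega>) \<partial>M)"
    by (subst (1 2) nn_integral_info_not_yet_changed[OF B g])
      (auto simp: emeasure_change_time_greater emeasure_change_time_Suc mult.assoc)
  show "(\<integral>\<^sup>+\<omega>. indicator {Suc k<..} (fst \<omega>) * g (info n B k \<omega>) \<partial>M) =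
      ennreal (1 - p) * (\<integral>\<^sup>+\<omega>. indicator {k<..} (fst \<omega>) * g (info n B k \<omega>) \<partial>M)"
    using rho_nonneg rho_le_1 p_pos p_le_1
    by (subst (1 2) nn_integral_info_not_yet_changed[OF B g])
      (auto simp: emeasure_change_time_greater ennreal_mult' ennreal_mult mult_ac)
qed

subsection \<open>The filter and the posterior probability\<close>

definition predict :: "real \<Rightarrow> real" where
  "predict x = x + (1 - x) * p"

text \<open>Predictive density of the next reception, relative to the awake weights; it is the
  denominator in Bayes' rule.\<close>

definition mixture :: "real \<Rightarrow> reception \<Rightarrow> real" where
  "mixture x r = predict x * likelihood n f1 r + (1 - predict x) * likelihood n f0 r"

text \<open>Where \<open>mixture x r\<close> vanishes the quotient takes the default value 0. The
  multiplied-out form of Bayes' rule survives there, and it is the form used below.\<close>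

definition update :: "real \<Rightarrow> reception \<Rightarrow> real" where
  "update x r = predict x * likelihood n f1 r / mixture x r"

text \<open>A version of the posterior defined at every point of the information space and always
  within [0, 1]. It reads the receptions only: the awake probabilities cancel in Bayes'
  rule.\<close>

primrec filter_prob :: "nat \<Rightarrow> info \<Rightarrow> real" where
  "filter_prob 0 I = \<rho>"
| "filter_prob (Suc k) I = update (filter_prob k I) (fst I (Suc k))"

lemma predict_bounds: "0 \<le> x \<Longrightarrow> x \<le> 1 \<Longrightarrow> 0 \<le> predict x \<and> predict x \<le> 1"
  using p_pos p_le_1 mult_left_le[of p "1 - x"] by (simp add: predict_def)

lemma one_minus_predict: "1 - predict x = (1 - p) * (1 - x)"
  by (simp add: predict_def algebra_simps)

lemma likelihoods_nonneg: "0 \<le> likelihood n f0 r" "0 \<le> likelihood n f1 r"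
  using densities_nonneg by (auto intro: likelihood_nonneg)

lemma mixture_nonneg: "0 \<le> x \<Longrightarrow> x \<le> 1 \<Longrightarrow> 0 \<le> mixture x r"
  using predict_bounds[of x] likelihoods_nonneg by (simp add: mixture_def)

lemma
  assumes "0 \<le> x" "x \<le> 1"
  shows mixture_times_update: "mixture x r * update x r = predict x * likelihood n f1 r"
    and mixture_times_one_minus_update: "mixture x r * (1 - update x r) = (1 - predict x) * likelihood n f0 r"
    and update_bounds: "0 \<le> update x r" "update x r \<le> 1"
proof -
  have nn: "0 \<le> predict x * likelihood n f1 r" "0 \<le> (1 - predict x) * likelihood n f0 r"
    using predict_bounds[OF assms] likelihoods_nonneg by simp_all
  show *: "mixture x r * update x r = predict x * likelihood n f1 r"
  proof (cases "mixture x r = 0")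
    case True
    \<comment> \<open>\<open>mixture x r\<close> is a sum of two nonnegative terms, so when it
      vanishes each of them does.\<close>
    with nn have "predict x * likelihood n f1 r = 0" by (simp only: mixture_def)
    with True show ?thesis by simp
  qed (simp add: update_def)
  show "mixture x r * (1 - update x r) = (1 - predict x) * likelihood n f0 r"
    unfolding right_diff_distrib * by (simp add: mixture_def)
  show "0 \<le> update x r" "update x r \<le> 1"
    using nn by (auto simp: update_def mixture_def divide_le_eq_1)
qed

lemma measurable_mixture[measurable]:
  "case_prod mixture \<in> borel_measurable (borel \<Otimes>\<^sub>M reception_space n)"
  unfolding mixture_def[abs_def] predict_def by measurable

lemma measurable_update[measurable]:
  "case_prod update \<in> borel_measurable (borel \<Otimes>\<^sub>M reception_space n)"
  unfolding update_def[abs_def] predict_def by measurable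

lemma filter_prob_bounds: "0 \<le> filter_prob k I" "filter_prob k I \<le> 1"
  by (induction k) (auto simp: rho_nonneg rho_le_1 update_bounds)

lemma measurable_filter_prob: "k \<le> m \<Longrightarrow> filter_prob k \<in> borel_measurable (info_space n m)"
proof (induction k)
  case 0
  have "filter_prob 0 = (\<lambda>_. \<rho>)" by auto
  then show ?case by simp
next
  case (Suc k)
  have [measurable]: "filter_prob k \<in> borel_measurable (info_space n m)" using Suc by simp
  have [measurable]: "(\<lambda>I. fst I (Suc k)) \<in> measurable (info_space n m) (reception_space n)"
    unfolding info_space_def using Suc.prems
    by (intro measurable_compose[OF measurable_fst] measurable_component_singleton) auto
  show ?case by simp
qed

lemma measurable_filter_prob_self[measurable]: "filter_prob k \<in> borel_measurable (info_space n k)"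
  by (rule measurable_filter_prob) simp

lemma filter_prob_extend_info: "k \<le> m \<Longrightarrow> filter_prob k (extend_info m I r a) = filter_prob k I"
  by (induction k) (simp_all add: extend_info_def)

lemma filter_prob_Suc_extend_info:
  "filter_prob (Suc k) (extend_info k I r a) = update (filter_prob k I) r"
  by (simp add: filter_prob_extend_info) (simp add: extend_info_def)

lemma observe_cmult:
  assumes B: "admissible n B" and [measurable]: "g \<in> borel_measurable (info_space n (Suc k))"
    "d \<in> borel_measurable (reception_space n)"
    and I[measurable]: "I \<in> space (info_space n k)" and c: "0 \<le> c"
  shows "ennreal c * observe B k (\<lambda>_. d) g I = observe B k (\<lambda>_ r. c * d r) g I"
proof -
  have Bk[measurable]: "B k \<in> measurable (info_space n k) action_space"
    using B by (simp add: admissible_def)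
  then have [measurable]: "B k I \<in> space action_space" using I by (rule measurable_space)
  show ?thesis unfolding observe_def
    by (subst nn_integral_cmult[symmetric]) (simp_all add: ennreal_mult'[OF c] mult.assoc)
qed

text \<open>Moves a weight of the test function into the density. It is applied to the weights \<pi>
  and 1 - \<pi> of the next time, where it produces the products that occur in Bayes' rule.\<close>

lemma observe_weight:
  assumes B: "admissible n B" and I: "I \<in> space (info_space n k)" and w: "\<And>r. 0 \<le> w I r"
    and "\<And>r. g (extend_info k I r (B k I)) = ennreal (w I r) * h (extend_info k I r (B k I))"
    and d: "\<And>r. 0 \<le> d I r"
  shows "observe B k d g I = observe B k (\<lambda>I r. d I r * w I r) h I"
proof -
  have "B k I \<in> space action_space"
    using B I by (auto simp: admissible_def intro: measurable_space)
  then have "0 \<le> awake_weight n (snd (B k I)) r" for r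
    by (auto simp: space_action_space intro!: awake_weight_nonneg)
  then show ?thesis
    using assms unfolding observe_def
    by (intro nn_integral_cong) (simp add: ennreal_mult mult_ac)
qed

lemma observe_add:
  assumes B: "admissible n B" and [measurable]: "g \<in> borel_measurable (info_space n (Suc k))"
    "d \<in> borel_measurable (reception_space n)" "d' \<in> borel_measurable (reception_space n)"
    and I[measurable]: "I \<in> space (info_space n k)" and nn: "\<And>r. 0 \<le> d r" "\<And>r. 0 \<le> d' r"
  shows "observe B k (\<lambda>_. d) g I + observe B k (\<lambda>_. d') g I = observe B k (\<lambda>_ r. d r + d' r) g I"
proof -
  have Bk[measurable]: "B k \<in> measurable (info_space n k) action_space"
    using B by (simp add: admissible_def)
  then have BkI[measurable]: "B k I \<in> space action_space" using I by (rule measurable_space)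
  then have "0 \<le> awake_weight n (snd (B k I)) r" for r
    by (auto simp: space_action_space intro!: awake_weight_nonneg)
  then show ?thesis unfolding observe_def
    by (subst nn_integral_add[symmetric])
      (simp_all add: nn distrib_right)
qed

lemma nn_integral_Suc_change_split:
  assumes [measurable]: "g \<in> borel_measurable M"
  shows "(\<integral>\<^sup>+\<omega>. indicator {..Suc k} (fst \<omega>) * g \<omega> \<partial>M) =
    (\<integral>\<^sup>+\<omega>. indicator {..k} (fst \<omega>) * g \<omega> \<partial>M) + (\<integral>\<^sup>+\<omega>. indicator {Suc k} (fst \<omega>) * g \<omega> \<partial>M)"
  by (subst nn_integral_add[symmetric]) (auto intro!: nn_integral_cong simp: indicator_def)

lemma nn_integral_observe_scale:
  assumes B: "admissible n B" and g: "g \<in> borel_measurable (info_space n (Suc k))"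
    and d: "d \<in> borel_measurable (reception_space n)" and c: "\<And>I. 0 \<le> c I"
  shows "(\<integral>\<^sup>+\<omega>. ennreal (c (info n B k \<omega>)) * observe B k (\<lambda>_. d) g (info n B k \<omega>) \<partial>M) =
    (\<integral>\<^sup>+\<omega>. observe B k (\<lambda>I r. c I * d r) g (info n B k \<omega>) \<partial>M)"
proof (rule nn_integral_cong)
  fix \<omega> assume "\<omega> \<in> space M"
  then have "info n B k \<omega> \<in> space (info_space n k)"
    by (rule measurable_space[OF measurable_info_sensor_measure[OF B]])
  from observe_cmult[OF B g d this c]
  show "ennreal (c (info n B k \<omega>)) * observe B k (\<lambda>_. d) g (info n B k \<omega>) =
      observe B k (\<lambda>I r. c I * d r) g (info n B k \<omega>)"
    by (simp add: observe_def)
qed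

lemma nn_integral_info_partition:
  assumes B: "admissible n B" and [measurable]: "g \<in> borel_measurable (info_space n k)"
  shows "(\<integral>\<^sup>+\<omega>. g (info n B k \<omega>) \<partial>M) =
    (\<integral>\<^sup>+\<omega>. indicator {..k} (fst \<omega>) * g (info n B k \<omega>) \<partial>M) +
    (\<integral>\<^sup>+\<omega>. indicator {k<..} (fst \<omega>) * g (info n B k \<omega>) \<partial>M)"
proof -
  note [measurable] = measurable_info_sensor_measure[OF B]
  show ?thesis
    by (subst nn_integral_add[symmetric]) (auto intro!: nn_integral_cong simp: indicator_def)
qed

text \<open>States that the filter is a version of the conditional probability of a change by time
  \<open>k\<close>, tested against nonnegative functions. The equation for the complementary event
  is carried along because the induction uses both, and for extended nonnegative \<open>g\<close>
  subtraction would not be safe.\<close>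

definition filter_correct :: "policy \<Rightarrow> nat \<Rightarrow> bool" where
  "filter_correct B k \<longleftrightarrow> (\<forall>g \<in> borel_measurable (info_space n k).
    (\<integral>\<^sup>+\<omega>. indicator {..k} (fst \<omega>) * g (info n B k \<omega>) \<partial>M) =
      (\<integral>\<^sup>+\<omega>. ennreal (filter_prob k (info n B k \<omega>)) * g (info n B k \<omega>) \<partial>M) \<and>
    (\<integral>\<^sup>+\<omega>. indicator {k<..} (fst \<omega>) * g (info n B k \<omega>) \<partial>M) =
      (\<integral>\<^sup>+\<omega>. ennreal (1 - filter_prob k (info n B k \<omega>)) * g (info n B k \<omega>) \<partial>M))"

lemma filter_correctD:
  assumes "filter_correct B k" "g \<in> borel_measurable (info_space n k)"
  shows "(\<integral>\<^sup>+\<omega>. indicator {..k} (fst \<omega>) * g (info n B k \<omega>) \<partial>M) =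
      (\<integral>\<^sup>+\<omega>. ennreal (filter_prob k (info n B k \<omega>)) * g (info n B k \<omega>) \<partial>M)"
    and "(\<integral>\<^sup>+\<omega>. indicator {k<..} (fst \<omega>) * g (info n B k \<omega>) \<partial>M) =
      (\<integral>\<^sup>+\<omega>. ennreal (1 - filter_prob k (info n B k \<omega>)) * g (info n B k \<omega>) \<partial>M)"
  using assms by (auto simp: filter_correct_def)

lemma filter_correct_0:
  assumes B: "admissible n B"
  shows "filter_correct B 0"
  unfolding filter_correct_def
proof
  fix g :: "info \<Rightarrow> ennreal" assume g: "g \<in> borel_measurable (info_space n 0)"
  interpret prob_space M by (rule prob_space_sensor_measure)
  have "{0<..} = {t. 0 < (t::nat)}" "{..0} = {0::nat}" by auto
  then show "(\<integral>\<^sup>+\<omega>. indicator {..0} (fst \<omega>) * g (info n B 0 \<omega>) \<partial>M) =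
      (\<integral>\<^sup>+\<omega>. ennreal (filter_prob 0 (info n B 0 \<omega>)) * g (info n B 0 \<omega>) \<partial>M) \<and>
    (\<integral>\<^sup>+\<omega>. indicator {0<..} (fst \<omega>) * g (info n B 0 \<omega>) \<partial>M) =
      (\<integral>\<^sup>+\<omega>. ennreal (1 - filter_prob 0 (info n B 0 \<omega>)) * g (info n B 0 \<omega>) \<partial>M)"
    using emeasure_change_time_greater[of 0] rho_nonneg rho_le_1
    unfolding nn_integral_info[OF B g]
    by (simp add: conditional_law_def nn_integral_multc emeasure_space_1
        prob_space.emeasure_space_1[OF prob_space_obs] prob_space.emeasure_space_1[OF prob_space_noise]
        emeasure_pmf_single pmf_change_time_0)
qed

text \<open>A change by \<open>Suc k\<close> either happened by \<open>k\<close>, with weight \<pi>,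
  or happens exactly at \<open>Suc k\<close>, with weight p (1 - \<pi>). The sum of the two weights
  is \<open>predict\<close> of \<pi>.\<close>

lemma nn_integral_observe_after_change:
  assumes B: "admissible n B" and C: "filter_correct B k"
    and g[measurable]: "g \<in> borel_measurable (info_space n (Suc k))"
  shows "(\<integral>\<^sup>+\<omega>. indicator {..Suc k} (fst \<omega>) * g (info n B (Suc k) \<omega>) \<partial>M) =
      (\<integral>\<^sup>+\<omega>. observe B k (\<lambda>I r. predict (filter_prob k I) * likelihood n f1 r) g (info n B k \<omega>) \<partial>M)"
proof -
  note [measurable] = measurable_info_sensor_measure[OF B]
  let ?I = "\<lambda>\<omega>. info n B k \<omega>" and ?\<pi> = "\<lambda>\<omega>. filter_prob k (info n B k \<omega>)"
  note IH = filter_correctD[OF C]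
    let ?G = "observe B k (\<lambda>_. likelihood n f1) g"
    have G[measurable]: "?G \<in> borel_measurable (info_space n k)"
      by (intro measurable_observe B g) simp
    have "(\<integral>\<^sup>+\<omega>. indicator {..Suc k} (fst \<omega>) * g (info n B (Suc k) \<omega>) \<partial>M) =
        (\<integral>\<^sup>+\<omega>. indicator {..k} (fst \<omega>) * ?G (?I \<omega>) \<partial>M) + (\<integral>\<^sup>+\<omega>. indicator {Suc k} (fst \<omega>) * ?G (?I \<omega>) \<partial>M)"
      unfolding nn_integral_info_Suc_after_change[OF B g] by (rule nn_integral_Suc_change_split) simp
    also have "\<dots> = (\<integral>\<^sup>+\<omega>. ennreal (?\<pi> \<omega>) * ?G (?I \<omega>) \<partial>M) +
        ennreal p * (\<integral>\<^sup>+\<omega>. ennreal (1 - ?\<pi> \<omega>) * ?G (?I \<omega>) \<partial>M)"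
      unfolding nn_integral_info_change_next(1)[OF B G] IH(1)[OF G] IH(2)[OF G] ..
    also have "\<dots> = (\<integral>\<^sup>+\<omega>. ennreal (?\<pi> \<omega>) * ?G (?I \<omega>) + ennreal p * (ennreal (1 - ?\<pi> \<omega>) * ?G (?I \<omega>)) \<partial>M)"
      by (subst nn_integral_cmult[symmetric], simp, subst nn_integral_add[symmetric]) simp_all
    also have "\<dots> = (\<integral>\<^sup>+\<omega>. ennreal (predict (?\<pi> \<omega>)) * ?G (?I \<omega>) \<partial>M)"
      using filter_prob_bounds p_pos
      by (simp add: predict_def distrib_right distrib_left ennreal_mult' mult_ac)
    also have "\<dots> = (\<integral>\<^sup>+\<omega>. observe B k (\<lambda>I r. predict (filter_prob k I) * likelihood n f1 r) g (?I \<omega>) \<partial>M)"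
      using predict_bounds filter_prob_bounds by (intro nn_integral_observe_scale B g) simp_all
    finally show ?thesis .
qed

lemma nn_integral_observe_before_change:
  assumes B: "admissible n B" and C: "filter_correct B k"
    and g[measurable]: "g \<in> borel_measurable (info_space n (Suc k))"
  shows "(\<integral>\<^sup>+\<omega>. indicator {Suc k<..} (fst \<omega>) * g (info n B (Suc k) \<omega>) \<partial>M) =
      (\<integral>\<^sup>+\<omega>. observe B k (\<lambda>I r. (1 - predict (filter_prob k I)) * likelihood n f0 r) g (info n B k \<omega>) \<partial>M)"
proof -
  note [measurable] = measurable_info_sensor_measure[OF B]
  let ?I = "\<lambda>\<omega>. info n B k \<omega>" and ?\<pi> = "\<lambda>\<omega>. filter_prob k (info n B k \<omega>)"
  note IH = filter_correctD[OF C]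
    let ?G = "observe B k (\<lambda>_. likelihood n f0) g"
    have G[measurable]: "?G \<in> borel_measurable (info_space n k)"
      by (intro measurable_observe B g) simp
    have "(\<integral>\<^sup>+\<omega>. indicator {Suc k<..} (fst \<omega>) * g (info n B (Suc k) \<omega>) \<partial>M) =
        ennreal (1 - p) * (\<integral>\<^sup>+\<omega>. ennreal (1 - ?\<pi> \<omega>) * ?G (?I \<omega>) \<partial>M)"
      unfolding nn_integral_info_Suc_before_change[OF B g] nn_integral_info_change_next(2)[OF B G]
        IH(2)[OF G] ..
    also have "\<dots> = (\<integral>\<^sup>+\<omega>. ennreal (1 - predict (?\<pi> \<omega>)) * ?G (?I \<omega>) \<partial>M)"
      using filter_prob_bounds p_le_1
      by (subst nn_integral_cmult[symmetric]) (simp_all add: one_minus_predict ennreal_mult' mult_ac)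
    also have "\<dots> = (\<integral>\<^sup>+\<omega>. observe B k (\<lambda>I r. (1 - predict (filter_prob k I)) * likelihood n f0 r) g (?I \<omega>) \<partial>M)"
      using predict_bounds filter_prob_bounds by (intro nn_integral_observe_scale B g) simp_all
    finally show ?thesis .
qed

text \<open>Adding the contributions of the two events removes the change time: the next reception
  depends on the past only through the filter and the chosen awake probability. This is the Markov
  property on which the dynamic programming rests.\<close>

lemma nn_integral_observe_mixture:
  assumes B: "admissible n B" and C: "filter_correct B k"
    and g[measurable]: "g \<in> borel_measurable (info_space n (Suc k))"
  shows "(\<integral>\<^sup>+\<omega>. g (info n B (Suc k) \<omega>) \<partial>M) =
      (\<integral>\<^sup>+\<omega>. observe B k (\<lambda>I. mixture (filter_prob k I)) g (info n B k \<omega>) \<partial>M)"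
proof -
  note [measurable] = measurable_info_sensor_measure[OF B]
  let ?I = "\<lambda>\<omega>. info n B k \<omega>" and ?\<pi> = "\<lambda>\<omega>. filter_prob k (info n B k \<omega>)"
    have meas: "observe B k d g \<in> borel_measurable (info_space n k)"
      if "case_prod d \<in> borel_measurable (info_space n k \<Otimes>\<^sub>M reception_space n)" for d
      using that by (intro measurable_observe B g)
    have "(\<lambda>I. observe B k (\<lambda>I r. predict (filter_prob k I) * likelihood n f1 r) g I) \<in> borel_measurable (info_space n k)"
      "(\<lambda>I. observe B k (\<lambda>I r. (1 - predict (filter_prob k I)) * likelihood n f0 r) g I) \<in> borel_measurable (info_space n k)"
      by (intro meas, simp add: predict_def)+
    note [measurable] = measurable_compose[OF measurable_info_sensor_measure[OF B] this(1)]
      measurable_compose[OF measurable_info_sensor_measure[OF B] this(2)]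
    show ?thesis
      unfolding nn_integral_info_partition[OF B g] nn_integral_observe_after_change[OF B C g] nn_integral_observe_before_change[OF B C g]
    proof (subst nn_integral_add[symmetric])
      show "(\<integral>\<^sup>+\<omega>. observe B k (\<lambda>I r. predict (filter_prob k I) * likelihood n f1 r) g (?I \<omega>) +
          observe B k (\<lambda>I r. (1 - predict (filter_prob k I)) * likelihood n f0 r) g (?I \<omega>) \<partial>M) =
        (\<integral>\<^sup>+\<omega>. observe B k (\<lambda>I. mixture (filter_prob k I)) g (?I \<omega>) \<partial>M)"
      proof (rule nn_integral_cong)
        fix \<omega> assume "\<omega> \<in> space M"
        then have I: "?I \<omega> \<in> space (info_space n k)"
          by (rule measurable_space[OF measurable_info_sensor_measure[OF B]])
        have "observe B k (\<lambda>_ r. predict (?\<pi> \<omega>) * likelihood n f1 r) g (?I \<omega>) +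
          observe B k (\<lambda>_ r. (1 - predict (?\<pi> \<omega>)) * likelihood n f0 r) g (?I \<omega>) =
          observe B k (\<lambda>_ r. predict (?\<pi> \<omega>) * likelihood n f1 r + (1 - predict (?\<pi> \<omega>)) * likelihood n f0 r) g (?I \<omega>)"
          using predict_bounds[OF filter_prob_bounds] likelihoods_nonneg
          by (intro observe_add B g I) simp_all
        then show "observe B k (\<lambda>I r. predict (filter_prob k I) * likelihood n f1 r) g (?I \<omega>) +
          observe B k (\<lambda>I r. (1 - predict (filter_prob k I)) * likelihood n f0 r) g (?I \<omega>) =
          observe B k (\<lambda>I. mixture (filter_prob k I)) g (?I \<omega>)"
          by (simp add: observe_def mixture_def)
      qed
    qed simp_all
qed

text \<open>Bayes' rule without division: weighting the predictive law by \<open>update\<close>, or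
  by its complement, returns the predicted mass after, or before, the change times its
  likelihood.\<close>

lemma filter_correct_Suc:
  assumes B: "admissible n B" and C: "filter_correct B k"
  shows "filter_correct B (Suc k)"
  unfolding filter_correct_def
proof
  note [measurable] = measurable_info_sensor_measure[OF B]
  let ?I = "\<lambda>\<omega>. info n B k \<omega>" and ?\<pi> = "\<lambda>\<omega>. filter_prob k (info n B k \<omega>)"
  fix g :: "info \<Rightarrow> ennreal" assume g[measurable]: "g \<in> borel_measurable (info_space n (Suc k))"
  have w: "(\<integral>\<^sup>+\<omega>. ennreal (v (filter_prob (Suc k) (info n B (Suc k) \<omega>))) * g (info n B (Suc k) \<omega>) \<partial>M) =
      (\<integral>\<^sup>+\<omega>. observe B k (\<lambda>I r. mixture (filter_prob k I) r * v (update (filter_prob k I) r)) g (?I \<omega>) \<partial>M)"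
    if v[measurable]: "v \<in> borel_measurable borel" and v_nonneg: "\<And>x. 0 \<le> x \<Longrightarrow> x \<le> 1 \<Longrightarrow> 0 \<le> v x" for v
  proof -
    have "(\<integral>\<^sup>+\<omega>. ennreal (v (filter_prob (Suc k) (info n B (Suc k) \<omega>))) * g (info n B (Suc k) \<omega>) \<partial>M) =
      (\<integral>\<^sup>+\<omega>. observe B k (\<lambda>I. mixture (filter_prob k I))
         (\<lambda>J. ennreal (v (filter_prob (Suc k) J)) * g J) (?I \<omega>) \<partial>M)"
      by (rule nn_integral_observe_mixture[OF B C]) (simp del: filter_prob.simps)
    also have "\<dots> = (\<integral>\<^sup>+\<omega>. observe B k (\<lambda>I r. mixture (filter_prob k I) r * v (update (filter_prob k I) r)) g (?I \<omega>) \<partial>M)"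
    proof (rule nn_integral_cong)
      fix \<omega> assume "\<omega> \<in> space M"
      then have I: "?I \<omega> \<in> space (info_space n k)"
        by (rule measurable_space[OF measurable_info_sensor_measure[OF B]])
      show "observe B k (\<lambda>I. mixture (filter_prob k I)) (\<lambda>J. ennreal (v (filter_prob (Suc k) J)) * g J) (?I \<omega>) =
        observe B k (\<lambda>I r. mixture (filter_prob k I) r * v (update (filter_prob k I) r)) g (?I \<omega>)"
        by (rule observe_weight[OF B I])
          (auto simp del: filter_prob.simps simp: filter_prob_Suc_extend_info v_nonneg update_bounds filter_prob_bounds mixture_nonneg)
    qed
    finally show ?thesis .
  qed
  show "(\<integral>\<^sup>+\<omega>. indicator {..Suc k} (fst \<omega>) * g (info n B (Suc k) \<omega>) \<partial>M) =
      (\<integral>\<^sup>+\<omega>. ennreal (filter_prob (Suc k) (info n B (Suc k) \<omega>)) * g (info n B (Suc k) \<omega>) \<partial>M) \<and>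
    (\<integral>\<^sup>+\<omega>. indicator {Suc k<..} (fst \<omega>) * g (info n B (Suc k) \<omega>) \<partial>M) =
      (\<integral>\<^sup>+\<omega>. ennreal (1 - filter_prob (Suc k) (info n B (Suc k) \<omega>)) * g (info n B (Suc k) \<omega>) \<partial>M)"
    unfolding nn_integral_observe_after_change[OF B C g] nn_integral_observe_before_change[OF B C g]
    using w[of "\<lambda>x. x"] w[of "\<lambda>x. 1 - x"] filter_prob_bounds
    by (simp add: mixture_times_update mixture_times_one_minus_update del: filter_prob.simps)
qed

lemma filter_correct:
  assumes "admissible n B"
  shows "filter_correct B k"
  using assms by (induction k) (simp_all add: filter_correct_0 filter_correct_Suc)

text \<open>The filter is measurable with respect to the information, and every event of the
  generated sigma-algebra is a preimage of some \<open>C\<close>. Testing filter correctness with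
  the indicator of \<open>C\<close> gives the defining integrals of the conditional
  expectation.\<close>

lemma posterior_eq_filter_prob:
  assumes B: "admissible n B"
  shows "AE \<omega> in M. posterior n \<rho> p f0 f1 B k \<omega> = filter_prob k (info n B k \<omega>)"
proof -
  let ?F = "vimage_algebra (space M) (info n B k) (info_space n k)"
  let ?T = "{\<omega> \<in> space M. fst \<omega> \<le> k}"
  note info[measurable] = measurable_info_sensor_measure[OF B]
  have info_Pi: "info n B k \<in> space M \<rightarrow> space (info_space n k)"
    using measurable_space[OF info] by blast
  interpret prob_space M by (rule prob_space_sensor_measure)
  have "subalgebra M ?F"
    unfolding subalgebra_def using sets_image_in_sets[OF refl info] by simp
  then interpret finite_measure_subalgebra M ?F
    by (intro finite_measure_subalgebra.intro finite_measure_axioms finite_measure_subalgebra_axioms.intro)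
  have F: "(\<lambda>\<omega>. filter_prob k (info n B k \<omega>)) \<in> borel_measurable ?F"
    by (rule measurable_compose[OF measurable_vimage_algebra1[OF info_Pi] measurable_filter_prob_self])
  have T[measurable]: "?T \<in> sets M" by measurable
  have "AE \<omega> in M. real_cond_exp M ?F (indicator ?T) \<omega> = filter_prob k (info n B k \<omega>)"
  proof (rule real_cond_exp_charact[OF _ _ _ F])
    fix A assume "A \<in> sets ?F"
    then obtain C where C[measurable]: "C \<in> sets (info_space n k)"
      and A: "A = info n B k -` C \<inter> space M"
      unfolding sets_vimage_algebra2[OF info_Pi] by blast
    have [measurable]: "A \<in> sets M" unfolding A by measurable
    have "(\<integral>\<^sup>+\<omega>. ennreal (indicator A \<omega> *\<^sub>R indicator ?T \<omega>) \<partial>M) =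
        (\<integral>\<^sup>+\<omega>. indicator {..k} (fst \<omega>) * indicator C (info n B k \<omega>) \<partial>M)"
      by (intro nn_integral_cong) (auto simp: A indicator_def)
    also have "\<dots> = (\<integral>\<^sup>+\<omega>. ennreal (filter_prob k (info n B k \<omega>)) * indicator C (info n B k \<omega>) \<partial>M)"
      by (rule filter_correctD(1)[OF filter_correct[OF B]]) simp
    also have "\<dots> = (\<integral>\<^sup>+\<omega>. ennreal (indicator A \<omega> *\<^sub>R filter_prob k (info n B k \<omega>)) \<partial>M)"
      by (intro nn_integral_cong) (auto simp: A indicator_def)
    finally show "(\<integral>\<omega>\<in>A. indicator ?T \<omega> \<partial>M) = (\<integral>\<omega>\<in>A. filter_prob k (info n B k \<omega>) \<partial>M)"
      unfolding set_lebesgue_integral_def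
      by (subst (1 2) integral_eq_nn_integral) (auto simp: filter_prob_bounds)
  next
    show "integrable M (indicator ?T :: _ \<Rightarrow> real)" by (simp add: emeasure_finite less_top[symmetric])
    show "integrable M (\<lambda>\<omega>. filter_prob k (info n B k \<omega>))"
      by (rule integrable_const_bound[where B=1]) (auto simp: filter_prob_bounds)
  qed
  then show ?thesis by (simp add: posterior_def Let_def)
qed

section \<open>The expected cost as a series over slots\<close>

definition stage_cost :: "real \<Rightarrow> real \<Rightarrow> policy \<Rightarrow> nat \<Rightarrow> info \<Rightarrow> ennreal" where
  "stage_cost lam_s lam_f B k I =
     (if fst (B k I) then ennreal (lam_f * (1 - filter_prob k I))
      else ennreal (filter_prob k I + lam_s * real n * snd (B k I)))"

text \<open>Read off from the actions recorded in the information, so that it is a function of the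
  information and can be part of a test function. An alarm raised at time \<open>k\<close> itself is
  not excluded.\<close>

definition running :: "nat \<Rightarrow> info \<Rightarrow> bool" where
  "running k I \<longleftrightarrow> (\<forall>j<k. \<not> fst (snd I j))"

lemma running_info: "running k (info n B k \<omega>) \<longleftrightarrow> (\<forall>j<k. \<not> fst (action_taken n B j \<omega>))"
proof -
  have "snd (info n B m \<omega>) j = action_taken n B j \<omega>" if "j < m" for j m
    using that by (induction m) (auto simp: info_Suc extend_info_def action_taken_def less_Suc_eq)
  then show ?thesis by (auto simp: running_def)
qed

lemma running_extend_info: "running (Suc k) (extend_info k I r a) \<longleftrightarrow> running k I \<and> \<not> fst a"
  by (auto simp: running_def extend_info_def less_Suc_eq)

lemma measurable_running[measurable]: "Measurable.pred (info_space n k) (running k)"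
proof -
  have snd_j: "(\<lambda>I. snd I j) \<in> measurable (info_space n k) action_space" if "j < k" for j
    using that unfolding info_space_def
    by (intro measurable_compose[OF measurable_snd] measurable_component_singleton) simp
  have "Measurable.pred (info_space n k) (\<lambda>I. j < k \<longrightarrow> \<not> fst (snd I j))" for j
  proof (cases "j < k")
    case True
    from measurable_action_components(1)[OF snd_j[OF True]] show ?thesis
      using True by simp
  qed simp
  then show ?thesis unfolding running_def[abs_def] by (rule pred_intros_countable)
qed

lemma measurable_stage_cost[measurable (raw)]:
  assumes "admissible n B"
  shows "stage_cost lam_s lam_f B k \<in> borel_measurable (info_space n k)"
proof -
  have [measurable]: "B k \<in> measurable (info_space n k) action_space"
    using assms by (simp add: admissible_def)
  show ?thesis unfolding stage_cost_def[abs_def] by measurable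
qed

text \<open>The false alarm cost is charged as the cost of the alarm slot and later slots cost
  nothing. One series then covers both finite and infinite alarm times.\<close>

definition alive_cost :: "real \<Rightarrow> real \<Rightarrow> policy \<Rightarrow> nat \<Rightarrow> sample \<Rightarrow> ennreal" where
  "alive_cost lam_s lam_f B k \<omega> =
     (if running k (info n B k \<omega>) then stage_cost lam_s lam_f B k (info n B k \<omega>) else 0)"

lemma measurable_alive_cost[measurable (raw)]:
  assumes "admissible n B"
  shows "alive_cost lam_s lam_f B k \<in> borel_measurable M"
proof -
  note [measurable] = measurable_info_sensor_measure[OF assms] measurable_stage_cost[OF assms]
  show ?thesis unfolding alive_cost_def[abs_def] by measurable
qed

lemma Inf_enat_image:
  "Inf (enat ` S) = (if S = {} then \<infinity> else enat (LEAST k. k \<in> S))"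
proof (cases "S = {}")
  case False
  then obtain k where k: "k \<in> S" by auto
  have "Inf (enat ` S) = enat (LEAST k. k \<in> S)"
    by (rule Inf_eqI) (use LeastI[of "\<lambda>k. k \<in> S", OF k] in \<open>auto intro: Least_le\<close>)
  with False show ?thesis by simp
qed (simp add: top_enat_def)

lemma total_cost_eq_suminf:
  assumes "\<And>k. posterior n \<rho> p f0 f1 B k \<omega> = filter_prob k (info n B k \<omega>)"
  shows "total_cost n \<rho> p lam_s lam_f f0 f1 B \<omega> = (\<Sum>k. alive_cost lam_s lam_f B k \<omega>)"
proof (cases "\<exists>k. fst (action_taken n B k \<omega>)")
  case False
  then have "alarm_time n B \<omega> = \<infinity>" by (simp add: alarm_time_def top_enat_def)
  with False show ?thesis
    using assms by (simp add: total_cost_def alive_cost_def running_info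
      stage_cost_def running_cost_def action_taken_def)
next
  case True
  define m where "m = (LEAST k. fst (action_taken n B k \<omega>))"
  have m: "fst (action_taken n B m \<omega>)" "\<And>k. k < m \<Longrightarrow> \<not> fst (action_taken n B k \<omega>)"
    unfolding m_def using LeastI_ex[OF True] by (auto dest: not_less_Least)
  have "alarm_time n B \<omega> = enat m"
    using True by (simp add: alarm_time_def Inf_enat_image m_def)
  \<comment> \<open>The sum runs to \<open>Suc m\<close>, since the alarm slot \<open>m\<close>
    still contributes the false alarm cost.\<close>
  moreover have "(\<Sum>k. alive_cost lam_s lam_f B k \<omega>) = (\<Sum>k<Suc m. alive_cost lam_s lam_f B k \<omega>)"
    using m(1) by (intro suminf_finite) (auto simp: alive_cost_def running_info)
  moreover have "alive_cost lam_s lam_f B k \<omega> = running_cost n \<rho> p lam_s f0 f1 B k \<omega>" if "k < m" for k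
    using m(2) that assms by (simp add: alive_cost_def running_info stage_cost_def running_cost_def action_taken_def)
  moreover have "alive_cost lam_s lam_f B m \<omega> = ennreal (lam_f * (1 - posterior n \<rho> p f0 f1 B m \<omega>))"
    using m assms by (simp add: alive_cost_def running_info stage_cost_def action_taken_def)
  ultimately show ?thesis by (simp add: total_cost_def add.commute)
qed

lemma expected_cost_eq_suminf:
  assumes B: "admissible n B"
  shows "expected_cost n \<rho> p lam_s lam_f f0 f1 B = (\<Sum>k. \<integral>\<^sup>+\<omega>. alive_cost lam_s lam_f B k \<omega> \<partial>M)"
proof -
  \<comment> \<open>The exceptional null sets for the countably many times are united.\<close>
  have "AE \<omega> in M. \<forall>k. posterior n \<rho> p f0 f1 B k \<omega> = filter_prob k (info n B k \<omega>)"
    using posterior_eq_filter_prob[OF B] by (simp add: AE_all_countable)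
  then have "expected_cost n \<rho> p lam_s lam_f f0 f1 B = (\<integral>\<^sup>+\<omega>. (\<Sum>k. alive_cost lam_s lam_f B k \<omega>) \<partial>M)"
    unfolding expected_cost_def by (intro nn_integral_cong_AE) (auto simp: total_cost_eq_suminf)
  then show ?thesis
    using measurable_alive_cost[OF B] by (simp add: nn_integral_suminf)
qed

end

subsection \<open>Measurable minimisers\<close>

text \<open>The approximating rational is taken to the right of \<open>t\<close>; the end point
  \<open>t = 1\<close> is treated apart, being rational itself.\<close>

lemma rational_approximation:
  fixes f :: "real \<Rightarrow> real"
  assumes "continuous_on {0..1} f" "t \<in> {0..1}" "0 < e"
  obtains r :: rat where "of_rat r \<in> {0..1::real}" "f (of_rat r) < f t + e"
proof (cases "t = 1")
  case True
  then show ?thesis using that[of 1] assms by simp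
next
  case False
  obtain d where d: "0 < d" "\<And>t'. t' \<in> {0..1} \<Longrightarrow> dist t' t < d \<Longrightarrow> dist (f t') (f t) < e"
    using assms unfolding continuous_on_iff by metis
  have "t < min 1 (t + d)" using False assms(2) d(1) by auto
  then obtain r :: rat where "t < of_rat r" "of_rat r < min 1 (t + d)"
    using of_rat_dense by blast
  moreover from this have "of_rat r \<in> {0..1::real}" using assms(2)
    unfolding atLeastAtMost_iff by linarith
  ultimately show ?thesis
    using that[of r] d(2)[of "of_rat r"] by (auto simp: dist_real_def abs_less_iff)
qed

text \<open>The smallest minimiser lies below \<open>c\<close> iff the infimum over \<open>[0, c]\<close> equals that over \<open>[0, 1]\<close>,
  and by continuity both infima may be taken over countable sets.\<close>

lemma measurable_argmin:
  fixes g :: "'a \<Rightarrow> real \<Rightarrow> real"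
  assumes meas[measurable]: "\<And>q. (\<lambda>x. g x q) \<in> borel_measurable N"
    and cont: "\<And>x. continuous_on {0..1} (g x)"
  obtains s where "s \<in> borel_measurable N" "\<And>x. s x \<in> {0..1}"
    "\<And>x q. q \<in> {0..1} \<Longrightarrow> g x (s x) \<le> g x q"
proof -
  define S where "S x = {q \<in> {0..1}. \<forall>q'\<in>{0..1}. g x q \<le> g x q'}" for x
  have S_ne: "S x \<noteq> {}" for x
    using continuous_attains_inf[OF _ _ cont[of x]] by (auto simp: S_def)
  have S_closed: "closed (S x)" for x
  proof -
    have "S x = (\<Inter>q'\<in>{0..1}. {q \<in> {0..1}. g x q \<le> g x q'})"
      unfolding S_def using atLeastAtMost_iff[of 0 0 "1::real"] zero_le_one by blast
    also have "closed \<dots>"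
      by (intro closed_INT ballI continuous_closed_preimage_constant continuous_on_closed_Collect_le
          cont continuous_on_const closed_atLeastAtMost)
    finally show ?thesis .
  qed
  have S_bdd: "bdd_below (S x)" for x by (auto simp: S_def intro!: bdd_belowI[of _ 0])
  have Inf_S: "Inf (S x) \<in> S x" for x
    using closed_contains_Inf[OF S_ne S_bdd S_closed] .
  then have S01: "0 \<le> Inf (S x)" "Inf (S x) \<le> 1" for x by (auto simp: S_def)
  have "(\<lambda>x. Inf (S x)) \<in> borel_measurable N"
  proof (rule borel_measurableI_le)
    fix c :: real
    consider "c < 0" | "1 \<le> c" | "0 \<le> c" "c < 1" by linarith
    then show "{x \<in> space N. Inf (S x) \<le> c} \<in> sets N"
    proof cases
      case 1
      then have "\<not> Inf (S x) \<le> c" for x using S01(1)[of x] by linarith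
      then have "{x \<in> space N. Inf (S x) \<le> c} = {}" by blast
      then show ?thesis by (simp only: sets.empty_sets)
    next
      case 2
      then have "Inf (S x) \<le> c" for x using S01(2)[of x] by linarith
      then have "{x \<in> space N. Inf (S x) \<le> c} = space N" by blast
      then show ?thesis by (simp only: sets.top)
    next
      case 3
      \<comment> \<open>Points of \<open>[0, c]\<close> are written as \<open>c\<close> times a
        point of \<open>[0, 1]\<close>, which gives a countable dense set even if \<open>c\<close>
        is irrational. The slack \<open>1 / Suc m\<close> turns the comparison of infima into
        countably many strict inequalities.\<close>
      have "Inf (S x) \<le> c \<longleftrightarrow> (\<forall>r::rat. \<forall>m::nat. of_rat r \<in> {0..1::real} \<longrightarrow>
          (\<exists>r'::rat. of_rat r' \<in> {0..1::real} \<and> g x (c * of_rat r') < g x (of_rat r) + 1 / Suc m))"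
        (is "_ \<longleftrightarrow> ?R") for x
      proof
        assume le: "Inf (S x) \<le> c"
        \<comment> \<open>The parameter with \<open>c * t = Inf (S x)\<close>. For
          \<open>c = 0\<close> the smallest minimiser is 0, so \<open>t = 0\<close> serves as
          well.\<close>
        define t where "t = (if c = 0 then 0 else Inf (S x) / c)"
        have t: "c * t = Inf (S x)" "t \<in> {0..1}"
          using le 3 Inf_S[of x] by (auto simp: t_def S_def)
        have cont': "continuous_on {0..1} (\<lambda>t. g x (c * t))"
          using 3 by (intro continuous_on_compose2[OF cont[of x]] continuous_intros)
            (auto intro!: mult_le_one)
        show ?R
        proof (intro allI impI)
          fix r :: rat and m :: nat assume "of_rat r \<in> {0..1::real}"
          then have "g x (c * t) \<le> g x (of_rat r)" using Inf_S[of x] t by (auto simp: S_def)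
          moreover obtain r' :: rat where "of_rat r' \<in> {0..1::real}" "g x (c * of_rat r') < g x (c * t) + 1 / Suc m"
            using rational_approximation[OF cont' t(2), of "1 / Suc m"] by auto
          ultimately show "\<exists>r'::rat. of_rat r' \<in> {0..1::real} \<and> g x (c * of_rat r') < g x (of_rat r) + 1 / Suc m"
            by (intro exI[of _ r']) auto
        qed
      next
        assume R: ?R
        have "continuous_on {0..c} (g x)" using cont by (rule continuous_on_subset) (use 3 in auto)
        \<comment> \<open>\<open>y\<close> minimises over \<open>[0, c]\<close>. The rational
          condition shows that it is a minimiser over all of \<open>[0, 1]\<close>, so the smallest
          one is at most \<open>y\<close>.\<close>
        then obtain y where y: "y \<in> {0..c}" "\<And>z. z \<in> {0..c} \<Longrightarrow> g x y \<le> g x z"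
          using continuous_attains_inf[of "{0..c}" "g x"] 3 by auto
        have y_rat: "g x y \<le> g x (of_rat r)" if r: "of_rat r \<in> {0..1::real}" for r :: rat
        proof (rule field_le_epsilon)
          fix e :: real assume "0 < e"
          then obtain m where m: "1 / Suc m < e" using nat_approx_posE by blast
          obtain r' :: rat where r': "of_rat r' \<in> {0..1::real}" "g x (c * of_rat r') < g x (of_rat r) + 1 / Suc m"
            using R[rule_format, OF r, of m] by blast
          have "c * of_rat r' \<in> {0..c}" using r'(1) 3 by (auto intro: mult_left_le)
          from y(2)[OF this] r'(2) m show "g x y \<le> g x (of_rat r) + e" by linarith
        qed
        have "g x y \<le> g x q" if "q \<in> {0..1}" for q
        proof (rule field_le_epsilon)
          fix e :: real assume "0 < e"
          from rational_approximation[OF cont that this]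
          obtain r :: rat where "of_rat r \<in> {0..1::real}" "g x (of_rat r) < g x q + e" by blast
          with y_rat[of r] show "g x y \<le> g x q + e" by linarith
        qed
        then have "y \<in> S x" using y(1) 3 by (auto simp: S_def)
        from cInf_lower[OF this S_bdd] y(1) show "Inf (S x) \<le> c" by simp
      qed
      then have "{x \<in> space N. Inf (S x) \<le> c} = {x \<in> space N. \<forall>r::rat. \<forall>m::nat. of_rat r \<in> {0..1::real} \<longrightarrow>
          (\<exists>r'::rat. of_rat r' \<in> {0..1::real} \<and> g x (c * of_rat r') < g x (of_rat r) + 1 / Suc m)}"
        by simp
      also have "\<dots> \<in> sets N" by measurable
      finally show ?thesis .
    qed
  qed
  then show ?thesis
    using Inf_S by (intro that[of "\<lambda>x. Inf (S x)"]) (auto simp: S_def)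
qed

subsection \<open>The Bellman operator\<close>

locale sensor_control = sensor_problem +
  fixes lam_s lam_f :: real
  assumes lam_s_nonneg: "0 \<le> lam_s" and lam_f_nonneg: "0 \<le> lam_f"
begin

text \<open>
  Value functions are extended from the probability \<open>\<pi>\<close> to pairs of masses \<open>(a, b)\<close>, standing for
  the unnormalised posterior masses after and before the change; \<open>(\<pi>, 1 - \<pi>)\<close> is the normalised
  case. For homogeneous functions, concavity in \<open>\<pi>\<close> becomes superadditivity in \<open>(a, b)\<close>.
\<close>

definition future :: "(ennreal \<Rightarrow> ennreal \<Rightarrow> ennreal) \<Rightarrow> real \<Rightarrow> ennreal \<Rightarrow> ennreal \<Rightarrow> ennreal" where
  "future W q a b =
     (\<integral>\<^sup>+r. W ((a + ennreal p * b) * ennreal (likelihood n f1 r))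
         (ennreal (1 - p) * b * ennreal (likelihood n f0 r)) * ennreal (awake_weight n q r)
       \<partial>reception_reference n)"

text \<open>Homogeneous form of the running cost: the delay cost falls on the mass \<open>a\<close>
  after the change, the sensing cost on the total mass \<open>a + b\<close>.\<close>

definition continuation :: "(ennreal \<Rightarrow> ennreal \<Rightarrow> ennreal) \<Rightarrow> real \<Rightarrow> ennreal \<Rightarrow> ennreal \<Rightarrow> ennreal" where
  "continuation W q a b = a + ennreal (lam_s * real n * q) * (a + b) + future W q a b"

text \<open>The infimum over the rationals keeps measurability at hand.\<close>

definition min_continuation :: "(ennreal \<Rightarrow> ennreal \<Rightarrow> ennreal) \<Rightarrow> ennreal \<Rightarrow> ennreal \<Rightarrow> ennreal" where
  "min_continuation W a b = (INF q\<in>{q::rat. of_rat q \<in> {0..1::real}}. continuation W (of_rat q) a b)"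

definition bellman :: "(ennreal \<Rightarrow> ennreal \<Rightarrow> ennreal) \<Rightarrow> ennreal \<Rightarrow> ennreal \<Rightarrow> ennreal" where
  "bellman W a b = min (ennreal lam_f * b) (min_continuation W a b)"

text \<open>Value iteration from above: with no slots left the alarm is forced, so the start is the
  stopping cost and not 0.\<close>

primrec finite_value :: "nat \<Rightarrow> ennreal \<Rightarrow> ennreal \<Rightarrow> ennreal" where
  "finite_value 0 = (\<lambda>a b. ennreal lam_f * b)"
| "finite_value (Suc N) = bellman (finite_value N)"

definition val :: "ennreal \<Rightarrow> ennreal \<Rightarrow> ennreal" where
  "val a b = (INF N. finite_value N a b)"

text \<open>Superadditivity together with scaling is concavity in homogeneous form; the upper bound
  says that stopping at once is always possible. Scaling is stated as an inequality because that
  form passes directly through infima and integrals; equality for finite factors follows by applying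
  it to the reciprocal.\<close>

definition value_like :: "(ennreal \<Rightarrow> ennreal \<Rightarrow> ennreal) \<Rightarrow> bool" where
  "value_like W \<longleftrightarrow> case_prod W \<in> borel_measurable (borel \<Otimes>\<^sub>M borel) \<and>
     (\<forall>a b a' b'. W a b + W a' b' \<le> W (a + a') (b + b')) \<and>
     (\<forall>c a b. c < \<top> \<longrightarrow> c * W a b \<le> W (c * a) (c * b)) \<and>
     (\<forall>a b. W a b \<le> ennreal lam_f * b)"

lemma
  assumes "value_like W"
  shows value_like_measurable[measurable_dest]: "case_prod W \<in> borel_measurable (borel \<Otimes>\<^sub>M borel)"
    and value_like_superadditive: "W a b + W a' b' \<le> W (a + a') (b + b')"
    and value_like_scale: "c < \<top> \<Longrightarrow> c * W a b \<le> W (c * a) (c * b)"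
    and value_like_le: "W a b \<le> ennreal lam_f * b"
  using assms by (auto simp: value_like_def)

text \<open>Superadditivity and nonnegativity give monotonicity: added mass contributes a value of
  its own.\<close>

lemma value_like_mono:
  assumes "value_like W" "a \<le> a'" "b \<le> b'"
  shows "W a b \<le> W a' b'"
proof -
  obtain c d where "a' = a + c" "b' = b + d" using assms(2,3) by (auto simp: le_iff_add)
  then show ?thesis
    using value_like_superadditive[OF assms(1), of a b c d] by (metis add_increasing2 order_refl order_trans zero_le)
qed

text \<open>The reverse inequality is the scaling inequality for \<open>1 / c\<close>. For
  \<open>c = 0\<close> the bound by the stopping cost forces the value 0.\<close>

lemma value_like_homogeneous:
  assumes W: "value_like W" and c: "0 \<le> c"
  shows "W (ennreal c * a) (ennreal c * b) = ennreal c * W a b"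
proof (cases "c = 0")
  case True
  then show ?thesis using value_like_le[OF W, of 0 0] by simp
next
  case False
  with c have c: "0 < c" by simp
  have inv: "ennreal c * (ennreal (1 / c) * x) = x" "ennreal (1 / c) * (ennreal c * x) = x" for x
    using c by (simp_all add: mult.assoc[symmetric] ennreal_mult'[symmetric])
  have "W (ennreal c * a) (ennreal c * b) =
      ennreal c * (ennreal (1 / c) * W (ennreal c * a) (ennreal c * b))"
    by (simp add: inv)
  also have "\<dots> \<le> ennreal c * W a b"
    using value_like_scale[OF W, of "ennreal (1 / c)" "ennreal c * a" "ennreal c * b"]
    by (intro mult_left_mono) (simp_all add: inv)
  finally show ?thesis using value_like_scale[OF W, of "ennreal c" a b] by (intro antisym) simp_all
qed

lemma measurable_future:
  assumes W: "value_like W" and [measurable]: "q \<in> borel_measurable N" "a \<in> borel_measurable N"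
    "b \<in> borel_measurable N"
  shows "(\<lambda>x. future W (q x) (a x) (b x)) \<in> borel_measurable N"
proof -
  interpret R: sigma_finite_measure "reception_reference n" by (rule sigma_finite_reception_reference)
  note [measurable] = value_like_measurable[OF W]
  show ?thesis unfolding future_def by measurable
qed

lemma future_integrand_measurable:
  assumes W: "value_like W"
  shows "(\<lambda>r. W (a * ennreal (likelihood n f1 r)) (b * ennreal (likelihood n f0 r)) *
      ennreal (awake_weight n q r)) \<in> borel_measurable (reception_reference n)"
proof -
  note [measurable] = value_like_measurable[OF W]
  show ?thesis by measurable
qed

lemma future_superadditive:
  assumes W: "value_like W"
  shows "future W q a b + future W q a' b' \<le> future W q (a + a') (b + b')"
proof -
  have "future W q a b + future W q a' b' =
    (\<integral>\<^sup>+r. W ((a + ennreal p * b) * ennreal (likelihood n f1 r))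
         (ennreal (1 - p) * b * ennreal (likelihood n f0 r)) * ennreal (awake_weight n q r) +
       W ((a' + ennreal p * b') * ennreal (likelihood n f1 r))
         (ennreal (1 - p) * b' * ennreal (likelihood n f0 r)) * ennreal (awake_weight n q r)
       \<partial>reception_reference n)"
    unfolding future_def
    by (rule nn_integral_add[symmetric]) (rule future_integrand_measurable[OF W])+
  also have "\<dots> \<le> future W q (a + a') (b + b')"
    unfolding future_def distrib_right[symmetric]
  proof (intro nn_integral_mono mult_right_mono)
    fix r
    show "W ((a + ennreal p * b) * ennreal (likelihood n f1 r))
         (ennreal (1 - p) * b * ennreal (likelihood n f0 r)) +
       W ((a' + ennreal p * b') * ennreal (likelihood n f1 r))
         (ennreal (1 - p) * b' * ennreal (likelihood n f0 r))
      \<le> W ((a + a' + ennreal p * (b + b')) * ennreal (likelihood n f1 r))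
         (ennreal (1 - p) * (b + b') * ennreal (likelihood n f0 r))"
      by (rule order_trans[OF value_like_superadditive[OF W]])
        (simp add: distrib_left distrib_right add_ac)
  qed simp
  finally show ?thesis .
qed

lemma future_scale:
  assumes W: "value_like W" and c: "c < \<top>"
  shows "c * future W q a b \<le> future W q (c * a) (c * b)"
proof -
  have "c * future W q a b = (\<integral>\<^sup>+r. c * (W ((a + ennreal p * b) * ennreal (likelihood n f1 r))
         (ennreal (1 - p) * b * ennreal (likelihood n f0 r)) * ennreal (awake_weight n q r))
       \<partial>reception_reference n)"
    unfolding future_def
    by (rule nn_integral_cmult[symmetric]) (rule future_integrand_measurable[OF W])
  also have "\<dots> \<le> future W q (c * a) (c * b)"
    unfolding future_def mult.assoc[of c, symmetric]
  proof (intro nn_integral_mono mult_right_mono)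
    fix r
    show "c * W ((a + ennreal p * b) * ennreal (likelihood n f1 r))
         (ennreal (1 - p) * b * ennreal (likelihood n f0 r))
      \<le> W ((c * a + ennreal p * (c * b)) * ennreal (likelihood n f1 r))
         (ennreal (1 - p) * (c * b) * ennreal (likelihood n f0 r))"
      by (rule order_trans[OF value_like_scale[OF W c]])
        (simp add: distrib_left distrib_right mult_ac)
  qed simp
  finally show ?thesis .
qed

lemma future_mono:
  assumes "\<And>a b. W a b \<le> W' a b"
  shows "future W q a b \<le> future W' q a b"
  unfolding future_def by (intro nn_integral_mono mult_right_mono assms) simp

lemma measurable_min_continuation:
  assumes W: "value_like W"
  shows "(\<lambda>x. min_continuation W (fst x) (snd x)) \<in> borel_measurable (borel \<Otimes>\<^sub>M borel)"
proof -
  have [measurable]: "(\<lambda>x. future W (of_rat q) (fst x) (snd x)) \<in> borel_measurable (borel \<Otimes>\<^sub>M borel)" for q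
    by (rule measurable_future[OF W]) simp_all
  show ?thesis unfolding min_continuation_def continuation_def
    by (rule borel_measurable_INF) simp_all
qed

text \<open>For each fixed \<open>q\<close> the continuation cost is superadditive, and any
  \<open>q\<close> used for the combined mass bounds both separate infima. This is concavity of an
  infimum of concave functions.\<close>

lemma min_continuation_superadditive:
  assumes W: "value_like W"
  shows "min_continuation W a b + min_continuation W a' b' \<le> min_continuation W (a + a') (b + b')"
  unfolding min_continuation_def
proof (rule INF_greatest)
  fix q :: rat assume q: "q \<in> {q. of_rat q \<in> {0..1::real}}"
  have "(INF q\<in>{q::rat. of_rat q \<in> {0..1::real}}. continuation W (of_rat q) a b) +
      (INF q\<in>{q::rat. of_rat q \<in> {0..1::real}}. continuation W (of_rat q) a' b') \<le>
      continuation W (of_rat q) a b + continuation W (of_rat q) a' b'"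
    by (intro add_mono INF_lower q)
  also have "\<dots> = (a + a') + ennreal (lam_s * real n * of_rat q) * ((a + a') + (b + b')) +
      (future W (of_rat q) a b + future W (of_rat q) a' b')"
    unfolding continuation_def by (simp add: distrib_left add_ac)
  also have "\<dots> \<le> continuation W (of_rat q) (a + a') (b + b')"
    unfolding continuation_def by (intro add_left_mono future_superadditive W)
  finally show "(INF q\<in>{q::rat. of_rat q \<in> {0..1::real}}. continuation W (of_rat q) a b) +
      (INF q\<in>{q::rat. of_rat q \<in> {0..1::real}}. continuation W (of_rat q) a' b') \<le>
      continuation W (of_rat q) (a + a') (b + b')" .
qed

lemma min_continuation_scale:
  assumes W: "value_like W" and c: "c < \<top>"
  shows "c * min_continuation W a b \<le> min_continuation W (c * a) (c * b)"
  unfolding min_continuation_def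
proof (rule INF_greatest)
  fix q :: rat assume q: "q \<in> {q. of_rat q \<in> {0..1::real}}"
  have "c * (INF q\<in>{q::rat. of_rat q \<in> {0..1::real}}. continuation W (of_rat q) a b) \<le>
      c * continuation W (of_rat q) a b"
    by (intro mult_left_mono INF_lower q) simp
  also have "\<dots> = c * a + ennreal (lam_s * real n * of_rat q) * (c * a + c * b) +
      c * future W (of_rat q) a b"
    unfolding continuation_def by (simp add: distrib_left distrib_right mult_ac)
  also have "\<dots> \<le> continuation W (of_rat q) (c * a) (c * b)"
    unfolding continuation_def by (intro add_left_mono future_scale W c)
  finally show "c * (INF q\<in>{q::rat. of_rat q \<in> {0..1::real}}. continuation W (of_rat q) a b) \<le>
      continuation W (of_rat q) (c * a) (c * b)" .
qed

lemma value_like_bellman: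
  assumes W: "value_like W"
  shows "value_like (bellman W)"
  unfolding value_like_def
proof (intro conjI allI impI)
  note [measurable] = measurable_min_continuation[OF W]
  show "case_prod (bellman W) \<in> borel_measurable (borel \<Otimes>\<^sub>M borel)"
    unfolding bellman_def[abs_def] case_prod_beta by measurable
  fix a b a' b'
  show "bellman W a b + bellman W a' b' \<le> bellman W (a + a') (b + b')"
    unfolding bellman_def
  proof (rule min.boundedI)
    show "min (ennreal lam_f * b) (min_continuation W a b) +
        min (ennreal lam_f * b') (min_continuation W a' b') \<le> ennreal lam_f * (b + b')"
      unfolding distrib_left by (intro add_mono min.cobounded1)
    show "min (ennreal lam_f * b) (min_continuation W a b) +
        min (ennreal lam_f * b') (min_continuation W a' b') \<le> min_continuation W (a + a') (b + b')"
      by (rule order_trans[OF add_mono min_continuation_superadditive[OF W]]) simp_all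
  qed
  show "bellman W a b \<le> ennreal lam_f * b"
    unfolding bellman_def by simp
  fix c :: ennreal assume c: "c < \<top>"
  have "c * bellman W a b \<le> c * (ennreal lam_f * b)" "c * bellman W a b \<le> c * min_continuation W a b"
    unfolding bellman_def by (intro mult_left_mono; simp)+
  then show "c * bellman W a b \<le> bellman W (c * a) (c * b)"
    using min_continuation_scale[OF W c, of a b] unfolding bellman_def[of W "c * a"]
    by (auto simp: mult_ac intro: order_trans)
qed

lemma bellman_mono:
  assumes "\<And>a b. W a b \<le> W' a b"
  shows "bellman W a b \<le> bellman W' a b"
  unfolding bellman_def min_continuation_def continuation_def
  by (intro min.mono INF_mono' add_left_mono future_mono assms) simp

lemma value_like_finite_value: "value_like (finite_value N)"
proof (induction N)
  case 0
  show ?case by (auto simp: value_like_def distrib_left mult_ac)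
qed (simp add: value_like_bellman)

lemma val_le_finite_value: "val a b \<le> finite_value N a b"
  unfolding val_def by (rule INF_lower) simp

lemma value_like_val: "value_like val"
  unfolding value_like_def
proof (intro conjI allI impI)
  have "(\<lambda>x. finite_value N (fst x) (snd x)) \<in> borel_measurable (borel \<Otimes>\<^sub>M borel)" for N
    using value_like_measurable[OF value_like_finite_value[of N]] by (simp add: case_prod_beta')
  then show "case_prod val \<in> borel_measurable (borel \<Otimes>\<^sub>M borel)"
    unfolding val_def[abs_def] case_prod_beta by (intro borel_measurable_INF) simp_all
  fix a b a' b'
  have "val a b + val a' b' \<le> finite_value N (a + a') (b + b')" for N
    by (rule order_trans[OF add_mono[OF val_le_finite_value val_le_finite_value]
          value_like_superadditive[OF value_like_finite_value]])
  then show "val a b + val a' b' \<le> val (a + a') (b + b')"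
    unfolding val_def[of "a + a'"] by (rule INF_greatest)
  show "val a b \<le> ennreal lam_f * b"
    using val_le_finite_value[of a b 0] by simp
  fix c :: ennreal assume c: "c < \<top>"
  have "c * val a b \<le> finite_value N (c * a) (c * b)" for N
    by (rule order_trans[OF mult_left_mono[OF val_le_finite_value]
          value_like_scale[OF value_like_finite_value c]]) simp
  then show "c * val a b \<le> val (c * a) (c * b)"
    unfolding val_def[of "c * a"] by (rule INF_greatest)
qed

text \<open>Monotonicity gives \<open>bellman val\<close> at most
  \<open>bellman (finite_value m)\<close>, which is the next iterate; the infimum over the iterates
  is then taken on the right only.\<close>

lemma bellman_val_le: "bellman val a b \<le> val a b"
  unfolding val_def[of a b]
proof (rule INF_greatest)
  fix N
  show "bellman val a b \<le> finite_value N a b"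
  proof (cases N)
    case 0
    then show ?thesis by (simp add: bellman_def)
  next
    case (Suc m)
    then show ?thesis by (simp add: bellman_mono val_le_finite_value)
  qed
qed

section \<open>Dependence on the awake probability: attaining the infimum\<close>

definition awake_count :: "reception \<Rightarrow> real" where
  "awake_count r = (\<Sum>i\<in>{1..n}. if fst (r i) then 1 else 0)"

lemma measurable_awake_count[measurable]: "awake_count \<in> borel_measurable (reception_space n)"
  unfolding awake_count_def[abs_def] by measurable

text \<open>Sorting the patterns by the number of awake sensors separates \<open>q\<close> from
  \<open>r\<close>. After integration \<open>future\<close> becomes a polynomial in
  \<open>q\<close>.\<close>

lemma awake_weight_eq_sum:
  "awake_weight n q r = (\<Sum>m\<le>n. (if awake_count r = real m then 1 else 0) * (q ^ m * (1 - q) ^ (n - m)))"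
proof -
  define c where "c = card {i \<in> {1..n}. fst (r i)}"
  have c: "awake_count r = real c"
    by (simp add: awake_count_def c_def sum.If_cases Int_def)
  have sub: "{i \<in> {1..n}. fst (r i)} \<subseteq> {1..n}" by blast
  from card_mono[OF _ this] have "c \<le> n" unfolding c_def by simp
  have "{1..n} \<inter> - {i. fst (r i)} = {1..n} - {i \<in> {1..n}. fst (r i)}" by auto
  then have "card ({1..n} \<inter> - {i. fst (r i)}) = n - c"
    unfolding c_def using card_Diff_subset[OF finite_subset[OF sub] sub] by simp
  then have "awake_weight n q r = q ^ c * (1 - q) ^ (n - c)"
    by (simp add: awake_weight_def prod.If_cases c_def Int_def)
  also have "\<dots> = (\<Sum>m\<le>n. if m = c then q ^ m * (1 - q) ^ (n - m) else 0)"
    using \<open>c \<le> n\<close> by simp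
  also have "\<dots> = (\<Sum>m\<le>n. (if awake_count r = real m then 1 else 0) * (q ^ m * (1 - q) ^ (n - m)))"
    unfolding c by (intro sum.cong refl) auto
  finally show ?thesis .
qed

lemma nn_integral_awake_weight:
  assumes q: "0 \<le> q" "q \<le> 1"
  shows "(\<integral>\<^sup>+r. ennreal (likelihood n f0 r * awake_weight n q r) \<partial>reception_reference n) = 1"
  \<comment> \<open>Slot 1 with change time 2 lies before the change, so its density is
    \<open>f0\<close>; the constant 1 as integrand then gives the total mass.\<close>
  using nn_integral_reception[where k=1 and q=q and G="\<lambda>_. 1" and t=2] q
  by (simp add: slot_density_def prob_space.emeasure_space_1[OF prob_space_obs]
      prob_space.emeasure_space_1[OF prob_space_noise])


text \<open>Coefficient of \<open>q ^ m * (1 - q) ^ (n - m)\<close>, collecting the receptions with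
  exactly \<open>m\<close> awake sensors; the binomial coefficient is absorbed in the sum over
  patterns.\<close>

definition future_coeff :: "(ennreal \<Rightarrow> ennreal \<Rightarrow> ennreal) \<Rightarrow> nat \<Rightarrow> ennreal \<Rightarrow> ennreal \<Rightarrow> ennreal" where
  "future_coeff W m a b =
     (\<integral>\<^sup>+r. W ((a + ennreal p * b) * ennreal (likelihood n f1 r))
         (ennreal (1 - p) * b * ennreal (likelihood n f0 r)) * (if awake_count r = real m then 1 else 0)
       \<partial>reception_reference n)"

lemma measurable_future_coeff:
  assumes W: "value_like W"
  shows "(\<lambda>x. future_coeff W m (fst x) (snd x)) \<in> borel_measurable (borel \<Otimes>\<^sub>M borel)"
proof -
  interpret R: sigma_finite_measure "reception_reference n" by (rule sigma_finite_reception_reference)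
  note [measurable] = value_like_measurable[OF W]
  show ?thesis unfolding future_coeff_def by measurable
qed

lemma future_eq_sum:
  assumes W: "value_like W" and q: "0 \<le> q" "q \<le> 1"
  shows "future W q a b = (\<Sum>m\<le>n. ennreal (q ^ m * (1 - q) ^ (n - m)) * future_coeff W m a b)"
proof -
  note [measurable] = value_like_measurable[OF W]
  have nn: "0 \<le> q ^ m * (1 - q) ^ (n - m)" for m using q by simp
  have w: "ennreal (awake_weight n q r) =
      (\<Sum>m\<le>n. ennreal (q ^ m * (1 - q) ^ (n - m)) * (if awake_count r = real m then 1 else 0))" for r
  proof -
    have "ennreal (awake_weight n q r) =
        (\<Sum>m\<le>n. ennreal ((if awake_count r = real m then 1 else 0) * (q ^ m * (1 - q) ^ (n - m))))"
      unfolding awake_weight_eq_sum using nn by (intro sum_ennreal[symmetric]) simp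
    also have "\<dots> = (\<Sum>m\<le>n. ennreal (q ^ m * (1 - q) ^ (n - m)) * (if awake_count r = real m then 1 else 0))"
      by (intro sum.cong refl) simp
    finally show ?thesis .
  qed
  let ?W = "\<lambda>r. W ((a + ennreal p * b) * ennreal (likelihood n f1 r))
         (ennreal (1 - p) * b * ennreal (likelihood n f0 r))"
  have "future W q a b = (\<integral>\<^sup>+r. (\<Sum>m\<le>n. ennreal (q ^ m * (1 - q) ^ (n - m)) *
      (?W r * (if awake_count r = real m then 1 else 0))) \<partial>reception_reference n)"
    unfolding future_def w sum_distrib_left by (simp only: mult_ac)
  also have "\<dots> = (\<Sum>m\<le>n. ennreal (q ^ m * (1 - q) ^ (n - m)) * future_coeff W m a b)"
    unfolding future_coeff_def
    by (subst nn_integral_sum, simp, subst nn_integral_cmult) simp_all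
  finally show ?thesis .
qed

lemma future_le:
  assumes W: "value_like W" and q: "0 \<le> q" "q \<le> 1"
  shows "future W q a b \<le> ennreal lam_f * (ennreal (1 - p) * b)"
proof -
  have nn: "0 \<le> awake_weight n q r" for r using q by (rule awake_weight_nonneg)
  have "future W q a b \<le> (\<integral>\<^sup>+r. ennreal lam_f * (ennreal (1 - p) * b * ennreal (likelihood n f0 r)) *
      ennreal (awake_weight n q r) \<partial>reception_reference n)"
    unfolding future_def by (intro nn_integral_mono mult_right_mono value_like_le[OF W]) simp
  also have "\<dots> = (\<integral>\<^sup>+r. ennreal lam_f * (ennreal (1 - p) * b) *
      ennreal (likelihood n f0 r * awake_weight n q r) \<partial>reception_reference n)"
    using likelihoods_nonneg nn by (simp add: ennreal_mult mult.assoc)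
  also have "\<dots> = ennreal lam_f * (ennreal (1 - p) * b)"
    by (subst nn_integral_cmult) (simp_all add: nn_integral_awake_weight[OF q])
  finally show ?thesis .
qed

text \<open>At \<open>q = 1/2\<close> every coefficient has positive weight, so each is dominated by
  a multiple of \<open>future W (1/2) a b\<close>, which the stopping cost bounds. Finiteness
  permits the passage to real polynomials.\<close>

lemma future_coeff_finite:
  assumes W: "value_like W" and "b < \<top>" "m \<le> n"
  shows "future_coeff W m a b < \<top>"
proof -
  have "ennreal ((1/2) ^ m * (1 - 1/2) ^ (n - m)) * future_coeff W m a b \<le> future W (1/2) a b"
    using \<open>m \<le> n\<close>
    by (subst future_eq_sum[OF W], simp, simp,
      intro member_le_sum[where f="\<lambda>m. ennreal ((1/2) ^ m * (1 - 1/2) ^ (n - m)) * future_coeff W m a b"])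
      simp_all
  also have "\<dots> \<le> ennreal lam_f * (ennreal (1 - p) * b)" by (rule future_le[OF W]) simp_all
  also have "\<dots> < \<top>" using \<open>b < \<top>\<close> by (simp add: ennreal_mult_less_top)
  finally show ?thesis by (auto simp: ennreal_mult_less_top)
qed

text \<open>The part of the continuation cost that depends on \<open>q\<close>, as a real function,
  so that continuity and measurable minimisation apply.\<close>

definition steering_cost :: "(ennreal \<Rightarrow> ennreal \<Rightarrow> ennreal) \<Rightarrow> real \<Rightarrow> real \<Rightarrow> real" where
  "steering_cost W x q = lam_s * real n * q +
     (\<Sum>m\<le>n. q ^ m * (1 - q) ^ (n - m) * enn2real (future_coeff W m (ennreal x) (ennreal (1 - x))))"

lemma measurable_steering_cost:
  assumes W: "value_like W"
  shows "(\<lambda>x. steering_cost W x q) \<in> borel_measurable borel"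
proof -
  have [measurable]: "(\<lambda>x. future_coeff W m (ennreal x) (ennreal (1 - x))) \<in> borel_measurable borel" for m
    using measurable_compose[of "\<lambda>x. (ennreal x, ennreal (1 - x))" borel _ _ borel, OF _ measurable_future_coeff[OF W]]
    by simp
  show ?thesis unfolding steering_cost_def by measurable
qed

lemma continuous_steering_cost: "continuous_on {0..1} (steering_cost W x)"
  unfolding steering_cost_def by (intro continuous_intros)

lemma continuation_eq_steering_cost:
  assumes W: "value_like W" and x: "0 \<le> x" "x \<le> 1" and q: "0 \<le> q" "q \<le> 1"
  shows "continuation W q (ennreal x) (ennreal (1 - x)) = ennreal x + ennreal (steering_cost W x q)"
proof -
  have one: "ennreal x + ennreal (1 - x) = 1"
    using x by (simp add: ennreal_plus[symmetric] del: ennreal_plus)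
  have "future W q (ennreal x) (ennreal (1 - x)) =
      (\<Sum>m\<le>n. ennreal (q ^ m * (1 - q) ^ (n - m)) * ennreal (enn2real (future_coeff W m (ennreal x) (ennreal (1 - x)))))"
    unfolding future_eq_sum[OF W q] using future_coeff_finite[OF W]
    by (intro sum.cong refl) simp
  also have "\<dots> = (\<Sum>m\<le>n. ennreal (q ^ m * (1 - q) ^ (n - m) * enn2real (future_coeff W m (ennreal x) (ennreal (1 - x)))))"
    using q by (intro sum.cong refl ennreal_mult[symmetric]) simp_all
  also have "\<dots> = ennreal (\<Sum>m\<le>n. q ^ m * (1 - q) ^ (n - m) * enn2real (future_coeff W m (ennreal x) (ennreal (1 - x))))"
    using q by (intro sum_ennreal) simp
  finally show ?thesis
    unfolding continuation_def steering_cost_def one using q lam_s_nonneg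
    by (simp add: add.assoc sum_nonneg)
qed

text \<open>The infimum ranges over rational \<open>q\<close> only; continuity of the polynomial
  extends the bound to every awake probability a policy may choose.\<close>

lemma min_continuation_le:
  assumes W: "value_like W" and x: "0 \<le> x" "x \<le> 1" and q: "0 \<le> q" "q \<le> 1"
  shows "min_continuation W (ennreal x) (ennreal (1 - x)) \<le> continuation W q (ennreal x) (ennreal (1 - x))"
proof (rule ennreal_le_epsilon)
  fix e :: real assume "0 < e"
  from rational_approximation[OF continuous_steering_cost[of W x] _ this, of q] q
  obtain r :: rat where r: "of_rat r \<in> {0..1::real}" "steering_cost W x (of_rat r) < steering_cost W x q + e"
    by auto
  have "min_continuation W (ennreal x) (ennreal (1 - x)) \<le> continuation W (of_rat r) (ennreal x) (ennreal (1 - x))"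
    unfolding min_continuation_def using r(1) by (intro INF_lower) simp
  also have "\<dots> = ennreal x + ennreal (steering_cost W x (of_rat r))"
    using r(1) by (intro continuation_eq_steering_cost W x) auto
  also have "\<dots> \<le> ennreal x + (ennreal (steering_cost W x q) + ennreal e)"
    using r(2) q lam_s_nonneg \<open>0 < e\<close>
    by (subst ennreal_plus[symmetric]) (auto simp: steering_cost_def intro!: add_left_mono ennreal_leI add_nonneg_nonneg sum_nonneg)
  also have "\<dots> = continuation W q (ennreal x) (ennreal (1 - x)) + ennreal e"
    by (simp add: continuation_eq_steering_cost[OF W x q] add.assoc)
  finally show "min_continuation W (ennreal x) (ennreal (1 - x)) \<le>
      continuation W q (ennreal x) (ennreal (1 - x)) + ennreal e" .
qed

lemma optimal_steering:
  assumes W: "value_like W"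
  obtains s where "s \<in> borel_measurable borel" "\<And>x. s x \<in> {0..1}"
    "\<And>x. 0 \<le> x \<Longrightarrow> x \<le> 1 \<Longrightarrow>
      continuation W (s x) (ennreal x) (ennreal (1 - x)) \<le> min_continuation W (ennreal x) (ennreal (1 - x))"
proof -
  obtain s where s: "s \<in> borel_measurable borel" "\<And>x. s x \<in> {0..1}"
    "\<And>x q. q \<in> {0..1} \<Longrightarrow> steering_cost W x (s x) \<le> steering_cost W x q"
    using measurable_argmin[of "steering_cost W" borel, OF measurable_steering_cost[OF W] continuous_steering_cost]
    by blast
  show ?thesis
  proof (rule that[OF s(1,2)])
    fix x :: real assume x: "0 \<le> x" "x \<le> 1"
    show "continuation W (s x) (ennreal x) (ennreal (1 - x)) \<le> min_continuation W (ennreal x) (ennreal (1 - x))"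
      unfolding min_continuation_def
    proof (rule INF_greatest)
      fix q :: rat assume "q \<in> {q. of_rat q \<in> {0..1::real}}"
      then show "continuation W (s x) (ennreal x) (ennreal (1 - x)) \<le>
          continuation W (of_rat q) (ennreal x) (ennreal (1 - x))"
        using s(2)[of x] s(3)[of "of_rat q" x]
        by (simp add: continuation_eq_steering_cost[OF W x] ennreal_leI add_left_mono)
    qed
  qed
qed

subsection \<open>The stopping set is an interval\<close>

text \<open>Ties count as stopping. This makes the stopping set closed on the left, in accordance
  with the weak inequality in \<open>threshold_time\<close>.\<close>

definition stops :: "(ennreal \<Rightarrow> ennreal \<Rightarrow> ennreal) \<Rightarrow> real \<Rightarrow> bool" where
  "stops W x \<longleftrightarrow> ennreal (lam_f * (1 - x)) \<le> min_continuation W (ennreal x) (ennreal (1 - x))"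

lemma stops_1: "stops W 1"
  by (simp add: stops_def)

text \<open>
  The pair \<open>(y, 1 - y)\<close> is \<open>c (x, 1 - x) + (1 - c, 0)\<close> with \<open>c = (1 - y) / (1 - x)\<close>, and
  \<open>c\<close> is also the ratio of the two stopping costs.
\<close>

lemma stops_upward:
  assumes W: "value_like W" and "stops W x" and xy: "0 \<le> x" "x \<le> y" "y \<le> 1"
  shows "stops W y"
proof (cases "x = 1")
  case True
  then show ?thesis using assms by simp
next
  case False
  define c where "c = (1 - y) / (1 - x)"
  have c: "0 \<le> c" "c \<le> 1" "c * (1 - x) = 1 - y"
    using False xy by (auto simp: c_def)
  have "c * x + (1 - c) = 1 - c * (1 - x)" by (simp add: algebra_simps)
  with c(3) have c_sum: "c * x + (1 - c) = y" by linarith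
  have "lam_f * (1 - y) = c * (lam_f * (1 - x))"
    unfolding c(3)[symmetric] by (rule mult.left_commute)
  then have "ennreal (lam_f * (1 - y)) = ennreal c * ennreal (lam_f * (1 - x))"
    using ennreal_mult'[OF c(1)] by metis
  also have "\<dots> \<le> ennreal c * min_continuation W (ennreal x) (ennreal (1 - x))"
    using assms(2) by (auto simp: stops_def intro: mult_left_mono)
  also have "\<dots> \<le> min_continuation W (ennreal c * ennreal x) (ennreal c * ennreal (1 - x))"
    by (intro min_continuation_scale W) simp
  \<comment> \<open>Adding the mass \<open>(1 - c, 0)\<close> can only raise the continuation cost,
    by superadditivity and nonnegativity.\<close>
  also have "\<dots> \<le> min_continuation W (ennreal c * ennreal x + ennreal (1 - c)) (ennreal c * ennreal (1 - x) + 0)"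
    by (rule order_trans[OF _ min_continuation_superadditive[OF W]]) simp
  also have "ennreal c * ennreal x + ennreal (1 - c) = ennreal y"
    using c c_sum xy by (simp add: ennreal_mult'[symmetric] ennreal_plus[symmetric] del: ennreal_plus)
  also have "ennreal c * ennreal (1 - x) + 0 = ennreal (1 - y)"
    using c by (simp add: ennreal_mult'[symmetric])
  finally show ?thesis by (simp add: stops_def)
qed

lemma predict_ennreal:
  assumes "0 \<le> x" "x \<le> 1"
  shows "ennreal x + ennreal p * ennreal (1 - x) = ennreal (predict x)"
    and "ennreal (1 - p) * ennreal (1 - x) = ennreal (1 - predict x)"
proof -
  show "ennreal x + ennreal p * ennreal (1 - x) = ennreal (predict x)"
    using assms p_pos
    by (simp add: ennreal_mult'[symmetric] ennreal_plus[symmetric] predict_def mult.commute del: ennreal_plus)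
  show "ennreal (1 - p) * ennreal (1 - x) = ennreal (1 - predict x)"
    using p_le_1 by (simp add: one_minus_predict ennreal_mult')
qed

lemma future_predict:
  assumes "0 \<le> x" "x \<le> 1"
  shows "future W q (ennreal x) (ennreal (1 - x)) =
    (\<integral>\<^sup>+r. W (ennreal (predict x) * ennreal (likelihood n f1 r))
        (ennreal (1 - predict x) * ennreal (likelihood n f0 r)) * ennreal (awake_weight n q r)
      \<partial>reception_reference n)"
  unfolding future_def predict_ennreal[OF assms] ..

lemma predict_pos: "0 \<le> x \<Longrightarrow> x \<le> 1 \<Longrightarrow> 0 < predict x"
  using p_pos p_le_1 by (cases "x = 0") (auto simp: predict_def intro!: add_pos_nonneg)

text \<open>
  A concave function may jump at \<open>0\<close>. Since \<open>predict x \<ge> p > 0\<close>, value functions are evaluated away from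
  the jump, and the factor \<open>predict x / predict y\<close> tends to \<open>1\<close> as \<open>y\<close> decreases to \<open>x\<close>.
\<close>

lemma future_left:
  assumes W: "value_like W" and xy: "0 \<le> x" "x \<le> y" "y \<le> 1"
  shows "ennreal (predict x / predict y) * future W q (ennreal y) (ennreal (1 - y)) \<le>
    future W q (ennreal x) (ennreal (1 - x))"
proof -
  define c where "c = predict x / predict y"
  have pos: "0 < predict x" "0 < predict y" using predict_pos xy by auto
  have "predict y - predict x = (y - x) * (1 - p)" by (simp add: predict_def algebra_simps)
  then have le: "predict x \<le> predict y" using xy p_le_1 by (smt (verit) mult_nonneg_nonneg)
  have c: "0 \<le> c" "c \<le> 1" "c * predict y = predict x" using pos le by (auto simp: c_def)
  have pb: "0 \<le> 1 - predict y" using predict_bounds[of y] xy by auto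
  \<comment> \<open>Scaling the predicted masses of \<open>y\<close> by \<open>c\<close> reproduces
    the first mass of \<open>x\<close> exactly and stays below its second one, so monotonicity of
    \<open>W\<close> can be applied.\<close>
  have "c * (1 - predict y) \<le> 1 * (1 - predict y)" using c pb by (intro mult_right_mono)
  also have "\<dots> \<le> 1 - predict x" using le by simp
  finally have c': "c * (1 - predict y) \<le> 1 - predict x" .
  have "0 \<le> y" "x \<le> 1" using xy by auto
  have "ennreal c * future W q (ennreal y) (ennreal (1 - y)) =
      (\<integral>\<^sup>+r. ennreal c * (W (ennreal (predict y) * ennreal (likelihood n f1 r))
        (ennreal (1 - predict y) * ennreal (likelihood n f0 r)) * ennreal (awake_weight n q r))
      \<partial>reception_reference n)"
    unfolding future_predict[OF \<open>0 \<le> y\<close> \<open>y \<le> 1\<close>]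
    by (rule nn_integral_cmult[symmetric]) (rule future_integrand_measurable[OF W])
  also have "\<dots> \<le> future W q (ennreal x) (ennreal (1 - x))"
    unfolding future_predict[OF \<open>0 \<le> x\<close> \<open>x \<le> 1\<close>] mult.assoc[of "ennreal c", symmetric]
  proof (intro nn_integral_mono mult_right_mono)
    fix r
    have "ennreal c * W (ennreal (predict y) * ennreal (likelihood n f1 r))
        (ennreal (1 - predict y) * ennreal (likelihood n f0 r)) \<le>
      W (ennreal c * (ennreal (predict y) * ennreal (likelihood n f1 r)))
        (ennreal c * (ennreal (1 - predict y) * ennreal (likelihood n f0 r)))"
      by (intro value_like_scale W) simp
    also have "\<dots> \<le> W (ennreal (predict x) * ennreal (likelihood n f1 r))
        (ennreal (1 - predict x) * ennreal (likelihood n f0 r))"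
      unfolding mult.assoc[symmetric] using c(1,3) c'
      by (intro value_like_mono[OF W] mult_right_mono) (simp_all add: ennreal_mult'[symmetric] ennreal_leI)
    finally show "ennreal c * W (ennreal (predict y) * ennreal (likelihood n f1 r))
        (ennreal (1 - predict y) * ennreal (likelihood n f0 r)) \<le>
      W (ennreal (predict x) * ennreal (likelihood n f1 r))
        (ennreal (1 - predict x) * ennreal (likelihood n f0 r))" .
  qed simp
  finally show ?thesis by (simp add: c_def)
qed

text \<open>All terms of the stopping inequality at \<open>y\<close> except \<open>future\<close>
  are continuous. Multiplied by the ratio of the predictions, the \<open>future\<close> term is at
  most its value at \<open>x\<close>, a constant, and \<open>y\<close> may decrease to
  \<open>x\<close>.\<close>

lemma stops_right_limit:
  assumes W: "value_like W" and x: "0 \<le> x" "x < 1" and stops: "\<And>y. x < y \<Longrightarrow> y \<le> 1 \<Longrightarrow> stops W y"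
  shows "stops W x"
  unfolding stops_def min_continuation_def
proof (rule INF_greatest)
  fix r :: rat assume r: "r \<in> {q. of_rat q \<in> {0..1::real}}"
  define q :: real where "q = of_rat r"
  have q: "0 \<le> q" using r by (simp add: q_def)
  have one: "ennreal z + ennreal (1 - z) = 1" if "0 \<le> z" "z \<le> 1" for z
    using that by (simp add: ennreal_plus[symmetric] del: ennreal_plus)
  let ?F = "\<lambda>z. future W q (ennreal z) (ennreal (1 - z))"
  let ?c = "\<lambda>y. predict x / predict y"
  have step: "ennreal (?c y * (lam_f * (1 - y))) \<le> ennreal (?c y * (y + lam_s * real n * q)) + ?F x"
    if y: "x < y" "y < 1" for y
  proof -
    have c: "0 \<le> ?c y" using predict_pos[of x] predict_pos[of y] x y by auto
    have "ennreal (lam_f * (1 - y)) \<le> continuation W q (ennreal y) (ennreal (1 - y))"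
      using stops[of y] y r unfolding stops_def min_continuation_def q_def
      by (auto intro: order_trans INF_lower)
    also have "\<dots> = ennreal (y + lam_s * real n * q) + ?F y"
      using x y q lam_s_nonneg by (simp add: continuation_def one)
    finally have "ennreal (?c y) * ennreal (lam_f * (1 - y)) \<le>
        ennreal (?c y) * (ennreal (y + lam_s * real n * q) + ?F y)"
      by (rule mult_left_mono) simp
    also have "\<dots> = ennreal (?c y * (y + lam_s * real n * q)) + ennreal (?c y) * ?F y"
      by (subst distrib_left, subst ennreal_mult'[OF c]) (rule refl)
    also have "\<dots> \<le> ennreal (?c y * (y + lam_s * real n * q)) + ?F x"
      using x y by (intro add_left_mono future_left W) auto
    finally show ?thesis by (subst ennreal_mult'[OF c])
  qed
  have px: "predict x \<noteq> 0" using predict_pos[of x] x by auto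
  have "((\<lambda>y. predict x / predict y) \<longlongrightarrow> predict x / predict x) (at_right x)"
    using px unfolding predict_def by (intro tendsto_intros) simp_all
  then have lim: "((\<lambda>y. predict x / predict y) \<longlongrightarrow> 1) (at_right x)" using px by simp
  have "ennreal (1 * (lam_f * (1 - x))) \<le> ennreal (1 * (x + lam_s * real n * q)) + ?F x"
  proof (rule tendsto_le[OF trivial_limit_at_right_real])
    show "((\<lambda>y. ennreal (?c y * (y + lam_s * real n * q)) + ?F x) \<longlongrightarrow>
        ennreal (1 * (x + lam_s * real n * q)) + ?F x) (at_right x)"
      by (intro tendsto_add tendsto_ennrealI tendsto_mult lim tendsto_ident_at tendsto_const)
    show "((\<lambda>y. ennreal (?c y * (lam_f * (1 - y)))) \<longlongrightarrow> ennreal (1 * (lam_f * (1 - x)))) (at_right x)"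
      by (intro tendsto_ennrealI tendsto_mult tendsto_diff lim tendsto_ident_at tendsto_const)
    show "\<forall>\<^sub>F y in at_right x. ennreal (?c y * (lam_f * (1 - y))) \<le> ennreal (?c y * (y + lam_s * real n * q)) + ?F x"
      using step \<open>x < 1\<close> by (auto simp: eventually_at_right)
  qed
  also have "\<dots> = continuation W q (ennreal x) (ennreal (1 - x))"
    using x q lam_s_nonneg by (simp add: continuation_def one)
  finally show "ennreal (lam_f * (1 - x)) \<le> continuation W (of_rat r) (ennreal x) (ennreal (1 - x))"
    by (simp add: q_def)
qed

text \<open>\<open>\<Gamma>\<close> is the infimum of the stopping set, which contains 1. Upward
  closedness yields every point above \<open>\<Gamma>\<close>, and the right limit adds
  \<open>\<Gamma>\<close> itself.\<close>

lemma stops_iff_threshold: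
  assumes W: "value_like W"
  obtains \<Gamma> where "\<Gamma> \<in> {0..1}" "\<And>x. 0 \<le> x \<Longrightarrow> x \<le> 1 \<Longrightarrow> stops W x \<longleftrightarrow> \<Gamma> \<le> x"
proof -
  define S where "S = {x \<in> {0..1}. stops W x}"
  define \<Gamma> where "\<Gamma> = Inf S"
  have "1 \<in> S" by (simp add: S_def stops_1)
  have bdd: "bdd_below S" by (auto simp: S_def intro!: bdd_belowI[of _ 0])
  have \<Gamma>_le: "\<Gamma> \<le> x" if "x \<in> S" for x unfolding \<Gamma>_def using that bdd by (rule cInf_lower)
  have \<Gamma>: "0 \<le> \<Gamma>" unfolding \<Gamma>_def using \<open>1 \<in> S\<close> by (intro cInf_greatest) (auto simp: S_def)
  have above: "stops W y" if "\<Gamma> < y" "y \<le> 1" for y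
  proof -
    have "S \<noteq> {}" using \<open>1 \<in> S\<close> by blast
    with \<open>\<Gamma> < y\<close> obtain x where x: "x \<in> S" "x < y"
      unfolding \<Gamma>_def using cInf_lessD by blast
    then have "stops W x" "0 \<le> x" by (simp_all add: S_def)
    then show ?thesis using x(2) \<open>y \<le> 1\<close> by (intro stops_upward[OF W \<open>stops W x\<close>]) simp_all
  qed
  have "stops W \<Gamma>"
  proof (cases "\<Gamma> = 1")
    case False
    then have "\<Gamma> < 1" using \<Gamma>_le[OF \<open>1 \<in> S\<close>] by simp
    from stops_right_limit[OF W \<Gamma> this above] show ?thesis .
  qed (simp add: stops_1)
  show ?thesis
  proof (rule that)
    show "\<Gamma> \<in> {0..1}" using \<Gamma> \<Gamma>_le[OF \<open>1 \<in> S\<close>] by simp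
    fix x :: real assume x: "0 \<le> x" "x \<le> 1"
    show "stops W x \<longleftrightarrow> \<Gamma> \<le> x"
    proof
      assume "stops W x"
      with x have "x \<in> S" by (simp add: S_def)
      then show "\<Gamma> \<le> x" by (rule \<Gamma>_le)
    next
      assume "\<Gamma> \<le> x"
      then show "stops W x" by (rule stops_upward[OF W \<open>stops W \<Gamma>\<close> \<Gamma> _ x(2)])
    qed
  qed
qed

subsection \<open>Optimality of the threshold policy\<close>

definition value_at :: "(ennreal \<Rightarrow> ennreal \<Rightarrow> ennreal) \<Rightarrow> nat \<Rightarrow> info \<Rightarrow> ennreal" where
  "value_at W k I = W (ennreal (filter_prob k I)) (ennreal (1 - filter_prob k I))"

text \<open>The expectation of the value function on the event that no alarm was raised before time
  \<open>k\<close>: a potential against which the costs paid are balanced.\<close>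

definition remaining_value :: "policy \<Rightarrow> (ennreal \<Rightarrow> ennreal \<Rightarrow> ennreal) \<Rightarrow> nat \<Rightarrow> ennreal" where
  "remaining_value B W k =
     (\<integral>\<^sup>+\<omega>. (if running k (info n B k \<omega>) then value_at W k (info n B k \<omega>) else 0) \<partial>M)"

lemma measurable_value_at:
  assumes W: "value_like W"
  shows "value_at W k \<in> borel_measurable (info_space n k)"
proof -
  note [measurable] = value_like_measurable[OF W]
  show ?thesis unfolding value_at_def[abs_def] by measurable
qed

text \<open>Homogeneity absorbs the normaliser of Bayes' rule, also where it vanishes.\<close>

lemma mixture_times_value:
  assumes W: "value_like W" and x: "0 \<le> x" "x \<le> 1"
  shows "ennreal (mixture x r) * W (ennreal (update x r)) (ennreal (1 - update x r)) =
    W (ennreal (predict x) * ennreal (likelihood n f1 r)) (ennreal (1 - predict x) * ennreal (likelihood n f0 r))"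
proof -
  have m: "0 \<le> mixture x r" using x by (rule mixture_nonneg)
  have "0 \<le> predict x" "0 \<le> 1 - predict x" using predict_bounds[OF x] by auto
  then show ?thesis
    unfolding value_like_homogeneous[OF W m, symmetric] ennreal_mult'[OF m, symmetric]
      mixture_times_update[OF x] mixture_times_one_minus_update[OF x]
    by (simp add: ennreal_mult')
qed

lemma remaining_value_Suc:
  assumes W: "value_like W" and B: "admissible n B"
  shows "remaining_value B W (Suc k) =
    (\<integral>\<^sup>+\<omega>. (let I = info n B k \<omega> in if running k I \<and> \<not> fst (B k I)
      then future W (snd (B k I)) (ennreal (filter_prob k I)) (ennreal (1 - filter_prob k I)) else 0) \<partial>M)"
proof -
  let ?g = "\<lambda>J. if running (Suc k) J then value_at W (Suc k) J else 0"
  note [measurable] = measurable_value_at[OF W]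
  have g: "?g \<in> borel_measurable (info_space n (Suc k))" by measurable
  have "remaining_value B W (Suc k) =
      (\<integral>\<^sup>+\<omega>. observe B k (\<lambda>I. mixture (filter_prob k I)) ?g (info n B k \<omega>) \<partial>M)"
    unfolding remaining_value_def
    by (rule nn_integral_observe_mixture[OF B filter_correct[OF B] g])
  also have "\<dots> = (\<integral>\<^sup>+\<omega>. (let I = info n B k \<omega> in if running k I \<and> \<not> fst (B k I)
      then future W (snd (B k I)) (ennreal (filter_prob k I)) (ennreal (1 - filter_prob k I)) else 0) \<partial>M)"
  proof (rule nn_integral_cong)
    fix \<omega> assume "\<omega> \<in> space M"
    define I where "I = info n B k \<omega>"
    have "I \<in> space (info_space n k)"
      unfolding I_def using \<open>\<omega> \<in> space M\<close> by (rule measurable_space[OF measurable_info_sensor_measure[OF B]])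
    then have "B k I \<in> space action_space"
      using B by (auto simp: admissible_def intro: measurable_space)
    then have w: "0 \<le> awake_weight n (snd (B k I)) r" for r
      by (auto simp: space_action_space intro!: awake_weight_nonneg)
    note x = filter_prob_bounds[of k I]
    have "observe B k (\<lambda>I. mixture (filter_prob k I)) ?g I =
        (\<integral>\<^sup>+r. (if running k I \<and> \<not> fst (B k I) then
          ennreal (mixture (filter_prob k I) r) *
            W (ennreal (update (filter_prob k I) r)) (ennreal (1 - update (filter_prob k I) r)) *
            ennreal (awake_weight n (snd (B k I)) r) else 0) \<partial>reception_reference n)"
      unfolding observe_def running_extend_info value_at_def filter_prob_Suc_extend_info
      by (intro nn_integral_cong) (auto simp: ennreal_mult[OF mixture_nonneg[OF x] w] mult_ac
          ennreal_mult[OF w mixture_nonneg[OF x]])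
    also have "\<dots> = (if running k I \<and> \<not> fst (B k I)
      then future W (snd (B k I)) (ennreal (filter_prob k I)) (ennreal (1 - filter_prob k I)) else 0)"
      unfolding mixture_times_value[OF W x] future_predict[OF x]
      by (cases "running k I"; cases "fst (B k I)") simp_all
    finally show "observe B k (\<lambda>I. mixture (filter_prob k I)) ?g (info n B k \<omega>) =
      (let I = info n B k \<omega> in if running k I \<and> \<not> fst (B k I)
      then future W (snd (B k I)) (ennreal (filter_prob k I)) (ennreal (1 - filter_prob k I)) else 0)"
      by (simp add: I_def Let_def)
  qed
  finally show ?thesis .
qed

lemma remaining_value_0: "remaining_value B W 0 = W (ennreal \<rho>) (ennreal (1 - \<rho>))"
  using prob_space.emeasure_space_1[OF prob_space_sensor_measure]
  by (simp add: remaining_value_def running_def value_at_def)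

text \<open>The right-hand side is one Bellman step with the action of \<open>B\<close> in place of
  the minimum. The lower bound for all policies and the upper bound for the threshold policy both
  compare it with that minimum.\<close>

lemma slot_cost_plus_remaining_value:
  assumes W: "value_like W" and B: "admissible n B"
  shows "(\<integral>\<^sup>+\<omega>. alive_cost lam_s lam_f B k \<omega> \<partial>M) + remaining_value B W (Suc k) =
    (\<integral>\<^sup>+\<omega>. (let I = info n B k \<omega> in
       if running k I then
         if fst (B k I) then ennreal (lam_f * (1 - filter_prob k I))
         else continuation W (snd (B k I)) (ennreal (filter_prob k I)) (ennreal (1 - filter_prob k I))
       else 0) \<partial>M)"
proof -
  note info[measurable] = measurable_info_sensor_measure[OF B] and [measurable] = measurable_alive_cost[OF B]
  have [measurable]: "B k \<in> measurable (info_space n k) action_space"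
    using B by (simp add: admissible_def)
  have [measurable]: "(\<lambda>I. future W (snd (B k I)) (ennreal (filter_prob k I)) (ennreal (1 - filter_prob k I)))
      \<in> borel_measurable (info_space n k)"
    by (rule measurable_future[OF W]) simp_all
  show ?thesis
    unfolding remaining_value_Suc[OF W B] Let_def
  proof (subst nn_integral_add[symmetric])
    show "(\<integral>\<^sup>+\<omega>. alive_cost lam_s lam_f B k \<omega> +
        (if running k (info n B k \<omega>) \<and> \<not> fst (B k (info n B k \<omega>))
         then future W (snd (B k (info n B k \<omega>))) (ennreal (filter_prob k (info n B k \<omega>)))
           (ennreal (1 - filter_prob k (info n B k \<omega>))) else 0) \<partial>M) =
      (\<integral>\<^sup>+\<omega>. (if running k (info n B k \<omega>) then
         if fst (B k (info n B k \<omega>)) then ennreal (lam_f * (1 - filter_prob k (info n B k \<omega>)))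
         else continuation W (snd (B k (info n B k \<omega>))) (ennreal (filter_prob k (info n B k \<omega>)))
           (ennreal (1 - filter_prob k (info n B k \<omega>)))
       else 0) \<partial>M)"
    proof (rule nn_integral_cong)
      fix \<omega> assume "\<omega> \<in> space M"
      define I where "I = info n B k \<omega>"
      have "I \<in> space (info_space n k)"
        unfolding I_def using \<open>\<omega> \<in> space M\<close> by (rule measurable_space[OF info])
      then have "B k I \<in> space action_space"
        using B by (auto simp: admissible_def intro: measurable_space)
      then have q: "0 \<le> snd (B k I)" by (auto simp: space_action_space)
      have one: "ennreal (filter_prob k I) + ennreal (1 - filter_prob k I) = 1"
        using filter_prob_bounds[of k I] by (simp add: ennreal_plus[symmetric] del: ennreal_plus)
      show "alive_cost lam_s lam_f B k \<omega> +
        (if running k (info n B k \<omega>) \<and> \<not> fst (B k (info n B k \<omega>))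
         then future W (snd (B k (info n B k \<omega>))) (ennreal (filter_prob k (info n B k \<omega>)))
           (ennreal (1 - filter_prob k (info n B k \<omega>))) else 0) =
        (if running k (info n B k \<omega>) then
         if fst (B k (info n B k \<omega>)) then ennreal (lam_f * (1 - filter_prob k (info n B k \<omega>)))
         else continuation W (snd (B k (info n B k \<omega>))) (ennreal (filter_prob k (info n B k \<omega>)))
           (ennreal (1 - filter_prob k (info n B k \<omega>)))
         else 0)"
        unfolding alive_cost_def stage_cost_def continuation_def I_def[symmetric] one
        using q lam_s_nonneg filter_prob_bounds[of k I] by simp
    qed
  qed simp_all
qed

text \<open>Whatever action \<open>B\<close> takes, its one-step cost is at least the Bellman
  minimum.\<close>

lemma finite_value_le:
  assumes B: "admissible n B"
  shows "remaining_value B (finite_value (Suc N)) k \<le>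
    (\<integral>\<^sup>+\<omega>. alive_cost lam_s lam_f B k \<omega> \<partial>M) + remaining_value B (finite_value N) (Suc k)"
  unfolding slot_cost_plus_remaining_value[OF value_like_finite_value B]
  unfolding remaining_value_def Let_def
proof (rule nn_integral_mono)
  fix \<omega> assume "\<omega> \<in> space M"
  define I where "I = info n B k \<omega>"
  have "I \<in> space (info_space n k)"
    unfolding I_def using \<open>\<omega> \<in> space M\<close> by (rule measurable_space[OF measurable_info_sensor_measure[OF B]])
  then have "B k I \<in> space action_space"
    using B by (auto simp: admissible_def intro: measurable_space)
  then have q: "0 \<le> snd (B k I)" "snd (B k I) \<le> 1" by (auto simp: space_action_space)
  have "value_at (finite_value (Suc N)) k I \<le> ennreal (lam_f * (1 - filter_prob k I))"
    using lam_f_nonneg by (simp add: value_at_def bellman_def ennreal_mult')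
  moreover have "value_at (finite_value (Suc N)) k I \<le>
      continuation (finite_value N) (snd (B k I)) (ennreal (filter_prob k I)) (ennreal (1 - filter_prob k I))"
    unfolding value_at_def finite_value.simps bellman_def
    by (intro min.coboundedI2 min_continuation_le value_like_finite_value filter_prob_bounds q)
  ultimately show "(if running k (info n B k \<omega>) then value_at (finite_value (Suc N)) k (info n B k \<omega>) else 0) \<le>
    (if running k (info n B k \<omega>) then
         if fst (B k (info n B k \<omega>)) then ennreal (lam_f * (1 - filter_prob k (info n B k \<omega>)))
         else continuation (finite_value N) (snd (B k (info n B k \<omega>))) (ennreal (filter_prob k (info n B k \<omega>)))
           (ennreal (1 - filter_prob k (info n B k \<omega>)))
       else 0)"
    unfolding I_def by simp
qed

lemma not_changed_probability:
  assumes B: "admissible n B"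
  shows "(\<integral>\<^sup>+\<omega>. ennreal (1 - filter_prob k (info n B k \<omega>)) \<partial>M) = ennreal ((1 - \<rho>) * (1 - p) ^ k)"
proof -
  have eq: "{k<..} = {t. k < t}" by auto
  have "(\<integral>\<^sup>+\<omega>. ennreal (1 - filter_prob k (info n B k \<omega>)) * 1 \<partial>M) =
      (\<integral>\<^sup>+\<omega>. indicator {k<..} (fst \<omega>) * 1 \<partial>M)"
    by (rule filter_correctD(2)[OF filter_correct[OF B], symmetric]) simp
  also have "\<dots> = ennreal ((1 - \<rho>) * (1 - p) ^ k) * conditional_law B k (\<lambda>_. 1) (Suc k)"
    using nn_integral_info_not_yet_changed[OF B, of "\<lambda>_. 1" k "{k<..}"]
    by (simp add: eq emeasure_change_time_greater)
  also have "conditional_law B k (\<lambda>_. 1) (Suc k) = 1"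
    by (simp add: conditional_law_def prob_space.emeasure_space_1[OF prob_space_obs]
        prob_space.emeasure_space_1[OF prob_space_noise])
  finally show ?thesis by simp
qed

lemma value_le_expected_cost:
  assumes B: "admissible n B"
  shows "val (ennreal \<rho>) (ennreal (1 - \<rho>)) \<le> expected_cost n \<rho> p lam_s lam_f f0 f1 B"
proof -
  let ?Z = "\<lambda>k. \<integral>\<^sup>+\<omega>. alive_cost lam_s lam_f B k \<omega> \<partial>M"
  \<comment> \<open>Each slot uses up one unit of the horizon, so the induction keeps
    \<open>N\<close> general and invokes its hypothesis at \<open>Suc N\<close>.\<close>
  have telescope: "remaining_value B (finite_value (m + N)) 0 \<le> (\<Sum>k<m. ?Z k) + remaining_value B (finite_value N) m" for m N
  proof (induction m arbitrary: N)
    case (Suc m)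
    have "remaining_value B (finite_value (Suc m + N)) 0 \<le>
        (\<Sum>k<m. ?Z k) + remaining_value B (finite_value (Suc N)) m"
      using Suc.IH[of "Suc N"] by simp
    also have "\<dots> \<le> (\<Sum>k<m. ?Z k) + (?Z m + remaining_value B (finite_value N) (Suc m))"
      by (intro add_left_mono finite_value_le B)
    finally show ?case by (simp add: add.assoc)
  qed simp
  have bound: "val (ennreal \<rho>) (ennreal (1 - \<rho>)) \<le> (\<Sum>k. ?Z k) + ennreal (lam_f * ((1 - \<rho>) * (1 - p) ^ m))" for m
  proof -
    note [measurable] = measurable_info_sensor_measure[OF B]
    have "remaining_value B (finite_value 0) m \<le> (\<integral>\<^sup>+\<omega>. ennreal lam_f * ennreal (1 - filter_prob m (info n B m \<omega>)) \<partial>M)"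
      unfolding remaining_value_def by (intro nn_integral_mono) (auto simp: value_at_def)
    also have "\<dots> = ennreal (lam_f * ((1 - \<rho>) * (1 - p) ^ m))"
      by (subst nn_integral_cmult) (simp_all add: not_changed_probability[OF B] ennreal_mult' lam_f_nonneg)
    finally have end_value: "remaining_value B (finite_value 0) m \<le> ennreal (lam_f * ((1 - \<rho>) * (1 - p) ^ m))" .
    have "val (ennreal \<rho>) (ennreal (1 - \<rho>)) \<le> remaining_value B (finite_value (m + 0)) 0"
      unfolding remaining_value_0 by (rule val_le_finite_value)
    also have "\<dots> \<le> (\<Sum>k<m. ?Z k) + remaining_value B (finite_value 0) m" by (rule telescope)
    also have "\<dots> \<le> (\<Sum>k. ?Z k) + ennreal (lam_f * ((1 - \<rho>) * (1 - p) ^ m))"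
      by (intro add_mono end_value sum_le_suminf) simp_all
    finally show ?thesis .
  qed
  \<comment> \<open>Here \<open>p > 0\<close> removes the terminal penalty as the horizon
    grows.\<close>
  have "(\<lambda>m. (1 - p) ^ m) \<longlonglongrightarrow> 0" using p_pos p_le_1 by (intro LIMSEQ_realpow_zero) simp_all
  then have "(\<lambda>m. lam_f * ((1 - \<rho>) * (1 - p) ^ m)) \<longlonglongrightarrow> 0"
    by (intro tendsto_mult_right_zero)
  then have "(\<lambda>m. (\<Sum>k. ?Z k) + ennreal (lam_f * ((1 - \<rho>) * (1 - p) ^ m))) \<longlonglongrightarrow> (\<Sum>k. ?Z k) + ennreal 0"
    by (intro tendsto_add tendsto_const tendsto_ennrealI)
  from LIMSEQ_le_const[OF this] bound have "val (ennreal \<rho>) (ennreal (1 - \<rho>)) \<le> (\<Sum>k. ?Z k) + ennreal 0" by blast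
  then show ?thesis by (simp add: expected_cost_eq_suminf[OF B])
qed

text \<open>Uses the filter and not \<open>posterior\<close>, since an action must be a measurable
  function of the information whereas \<open>posterior\<close> is a function of the sample
  point.\<close>

definition threshold_policy :: "real \<Rightarrow> (real \<Rightarrow> real) \<Rightarrow> policy" where
  "threshold_policy \<Gamma> s k I =
     (if \<Gamma> \<le> filter_prob k I then (True, 0) else (False, s (filter_prob k I)))"

lemma admissible_threshold_policy:
  assumes [measurable]: "s \<in> borel_measurable borel" and "\<And>x. s x \<in> {0..1}"
  shows "admissible n (threshold_policy \<Gamma> s)"
  unfolding admissible_def
proof
  fix k
  have "threshold_policy \<Gamma> s k \<in> measurable (info_space n k) (count_space UNIV \<Otimes>\<^sub>M borel)"
    unfolding threshold_policy_def[abs_def] by measurable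
  then show "threshold_policy \<Gamma> s k \<in> measurable (info_space n k) action_space"
    using assms(2) unfolding action_space_def
    by (intro measurable_restrict_space2) (auto simp: threshold_policy_def)
qed

text \<open>Under this policy the costs paid so far plus the remaining value never increase in
  expectation, because its action attains the Bellman minimum and that minimum is at most
  \<open>val\<close>.\<close>

lemma expected_cost_threshold_policy_le:
  assumes s: "s \<in> borel_measurable borel" "\<And>x. s x \<in> {0..1}"
    "\<And>x. 0 \<le> x \<Longrightarrow> x \<le> 1 \<Longrightarrow>
      continuation val (s x) (ennreal x) (ennreal (1 - x)) \<le> min_continuation val (ennreal x) (ennreal (1 - x))"
    and \<Gamma>: "\<And>x. 0 \<le> x \<Longrightarrow> x \<le> 1 \<Longrightarrow> stops val x \<longleftrightarrow> \<Gamma> \<le> x"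
  shows "expected_cost n \<rho> p lam_s lam_f f0 f1 (threshold_policy \<Gamma> s) \<le> val (ennreal \<rho>) (ennreal (1 - \<rho>))"
proof -
  let ?A = "threshold_policy \<Gamma> s"
  have A: "admissible n ?A" using s(1,2) by (rule admissible_threshold_policy)
  let ?Z = "\<lambda>k. \<integral>\<^sup>+\<omega>. alive_cost lam_s lam_f ?A k \<omega> \<partial>M"
  have step: "?Z k + remaining_value ?A val (Suc k) \<le> remaining_value ?A val k" for k
    unfolding slot_cost_plus_remaining_value[OF value_like_val A]
    unfolding remaining_value_def Let_def
  proof (rule nn_integral_mono)
    fix \<omega>
    define I where "I = info n ?A k \<omega>"
    note x = filter_prob_bounds[of k I]
    have "(if fst (?A k I) then ennreal (lam_f * (1 - filter_prob k I))
         else continuation val (snd (?A k I)) (ennreal (filter_prob k I)) (ennreal (1 - filter_prob k I)))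
      \<le> bellman val (ennreal (filter_prob k I)) (ennreal (1 - filter_prob k I))"
    proof (cases "\<Gamma> \<le> filter_prob k I")
      case True
      then have "stops val (filter_prob k I)" using \<Gamma>[OF x] by simp
      with True show ?thesis
        by (simp add: threshold_policy_def bellman_def stops_def ennreal_mult' lam_f_nonneg)
    next
      case False
      then have "\<not> stops val (filter_prob k I)" using \<Gamma>[OF x] by simp
      then have "bellman val (ennreal (filter_prob k I)) (ennreal (1 - filter_prob k I)) =
          min_continuation val (ennreal (filter_prob k I)) (ennreal (1 - filter_prob k I))"
        by (simp add: bellman_def stops_def ennreal_mult' lam_f_nonneg min_def)
      with False s(3)[OF x] show ?thesis by (simp add: threshold_policy_def)
    qed
    also have "\<dots> \<le> value_at val k I" unfolding value_at_def by (rule bellman_val_le)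
    finally show "(if running k (info n ?A k \<omega>) then
         if fst (?A k (info n ?A k \<omega>)) then ennreal (lam_f * (1 - filter_prob k (info n ?A k \<omega>)))
         else continuation val (snd (?A k (info n ?A k \<omega>))) (ennreal (filter_prob k (info n ?A k \<omega>)))
           (ennreal (1 - filter_prob k (info n ?A k \<omega>)))
       else 0) \<le> (if running k (info n ?A k \<omega>) then value_at val k (info n ?A k \<omega>) else 0)"
      unfolding I_def by simp
  qed
  have partial: "(\<Sum>k<m. ?Z k) + remaining_value ?A val m \<le> val (ennreal \<rho>) (ennreal (1 - \<rho>))" for m
  proof (induction m)
    case (Suc m)
    have "(\<Sum>k<Suc m. ?Z k) + remaining_value ?A val (Suc m) \<le> (\<Sum>k<m. ?Z k) + remaining_value ?A val m"
      using add_left_mono[OF step[of m], of "\<Sum>k<m. ?Z k"] by (simp add: add.assoc)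
    with Suc show ?case by (rule order_trans[rotated])
  qed (simp add: remaining_value_0)
  have "(\<Sum>k. ?Z k) \<le> val (ennreal \<rho>) (ennreal (1 - \<rho>))"
  \<comment> \<open>The remaining value is nonnegative and is dropped, which also covers sample
    points without an alarm.\<close>
  proof (rule suminf_le_const)
    show "(\<Sum>k<m. ?Z k) \<le> val (ennreal \<rho>) (ennreal (1 - \<rho>))" for m
      using partial[of m] by (rule order_trans[rotated]) simp
  qed simp
  then show ?thesis by (simp add: expected_cost_eq_suminf[OF A])
qed

lemma alarm_time_threshold_policy:
  assumes "admissible n (threshold_policy \<Gamma> s)"
  shows "AE \<omega> in M. alarm_time n (threshold_policy \<Gamma> s) \<omega> =
    threshold_time n \<rho> p f0 f1 \<Gamma> (threshold_policy \<Gamma> s) \<omega>"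
proof -
  have "AE \<omega> in M. \<forall>k. posterior n \<rho> p f0 f1 (threshold_policy \<Gamma> s) k \<omega> =
      filter_prob k (info n (threshold_policy \<Gamma> s) k \<omega>)"
    using posterior_eq_filter_prob[OF assms] by (simp add: AE_all_countable)
  then show ?thesis
    by eventually_elim (simp add: alarm_time_def threshold_time_def action_taken_def threshold_policy_def)
qed

lemma optimal_threshold_policy:
  "\<exists>\<Gamma>\<in>{0..1}. \<exists>A. optimal_policy n \<rho> p lam_s lam_f f0 f1 A \<and>
     (AE \<omega> in M. alarm_time n A \<omega> = threshold_time n \<rho> p f0 f1 \<Gamma> A \<omega>)"
proof -
  obtain s where s: "s \<in> borel_measurable borel" "\<And>x. s x \<in> {0..1}"
    "\<And>x. 0 \<le> x \<Longrightarrow> x \<le> 1 \<Longrightarrow>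
      continuation val (s x) (ennreal x) (ennreal (1 - x)) \<le> min_continuation val (ennreal x) (ennreal (1 - x))"
    using optimal_steering[OF value_like_val] by blast
  obtain \<Gamma> where \<Gamma>: "\<Gamma> \<in> {0..1}" "\<And>x. 0 \<le> x \<Longrightarrow> x \<le> 1 \<Longrightarrow> stops val x \<longleftrightarrow> \<Gamma> \<le> x"
    using stops_iff_threshold[OF value_like_val] by blast
  have A: "admissible n (threshold_policy \<Gamma> s)" using s(1,2) by (rule admissible_threshold_policy)
  have "optimal_policy n \<rho> p lam_s lam_f f0 f1 (threshold_policy \<Gamma> s)"
    using A expected_cost_threshold_policy_le[OF s \<Gamma>(2)] value_le_expected_cost
    unfolding optimal_policy_def by (blast intro: order_trans)
  with alarm_time_threshold_policy[OF A] \<Gamma>(1) show ?thesis by blast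
qed

end

theorem theorem6:
  fixes n :: nat and \<rho> p lam_s lam_f :: real and f0 f1 :: "real \<Rightarrow> real"
  assumes "n \<ge> 1" and "0 < p" and "p \<le> 1" and "0 \<le> \<rho>" and "\<rho> \<le> 1"
    and "0 \<le> lam_s" and "0 \<le> lam_f"
    and "prob_density f0" and "prob_density f1" and "f0 \<noteq> f1"
  shows "\<exists>\<Gamma>\<in>{0..1}. \<exists>A. optimal_policy n \<rho> p lam_s lam_f f0 f1 A \<and>
           (AE \<omega> in sensor_measure n \<rho> p f0 f1.
              alarm_time n A \<omega> = threshold_time n \<rho> p f0 f1 \<Gamma> A \<omega>)"
proof -
  interpret sensor_control n f0 f1 \<rho> p lam_s lam_f
    using assms by unfold_locales
  show ?thesis by (rule optimal_threshold_policy)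
qed

end
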